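(* Let $\Sigma$ be a finite set, let $p\in\Delta(\Sigma)$ have full support, let $G=(G_u)_{u\in\Sigma}$ be a random vector with support $\mathbb{G}\subseteq\mathbb{R}^{|\Sigma|}$ and i.i.d. coordinates from a law $\mathcal{L}$, and let $\varepsilon\ge0$. Consider the optimization problem $$q^*\in\arg\max_{q:\mathbb{G}\to\Delta(\Sigma)}\ \mathbb{E}\big[G\cdot q(G)\big]\quad\text{subject to}\quad \mathrm{KL}\big(\mathbb{E}[q(G)]\,\|\,p\big)\le\varepsilon .$$ Then there exist a vector $\tau\in\mathbb{R}^{|\Sigma|}$ and a measurable tie-breaking function $T:\mathbb{G}\times\Sigma\to[0,1]$, $(g,u)\mapsto T_u(g)$, such that an optimal solution is given by $$q^*(G)_u=\begin{cases}1&\text{if }\{u\}=M(G,\tau),\\ T_u(G)&\text{if }u\in M(G,\tau)\text{ and }|M(G,\tau)|>1,\\ 0&\text{otherwise,}\end{cases}$$ where $M(G,\tau)=\arg\max_{v\in\Sigma}(G_v+\tau_v)$ denotes the set of maximizing indices. The tie-breaking weights satisfy $\sum_{u\in M(G,\tau)}T_u(G)=1$ for all $G$, and $T,\tau$ are chosen such that $\mathrm{KL}(\mathbb{E}[q^*(G)]\|p)=\varepsilon$ (unless $\tau=0$ is feasible). In particular, if $G$ has i.i.d. standard Gumbel coordinates, there exists $\alpha\in[0,1]$ such that an optimal solution is given by $$\forall u\in\Sigma,\qquad q^*(G)_u=\mathbf{1}\Big\{u\in\arg\max_{v\in\Sigma}\big(G_v+\alpha\log p_v\big)\Big\},$$ and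 $\alpha$ is chosen so that $\mathrm{KL}(\mathbb{E}[q^*(G)]\|p)=\varepsilon$ if feasible, else $\alpha=0$.
   Context: $\Delta(\Sigma)$ is the set of probability vectors on the finite set $\Sigma$; full support means $p_u>0$ for all $u\in\Sigma$. The dot product is $g\cdot q=\sum_{u\in\Sigma}g_uq_u$. $\mathrm{KL}(r\|p)=\sum_{u\in\Sigma}r_u\log\frac{r_u}{p_u}$, with the convention $0\log 0=0$. The expectation $\mathbb{E}[q(G)]\in\Delta(\Sigma)$ is taken coordinatewise over $G$. The standard Gumbel law has distribution function $x\mapsto e^{-e^{-x}}$.
   Formalization: The general part assumes the law has finite mean, so that E[G·q(G)] is defined; in the Gumbel part the optimal q* equals the displayed indicator rule almost surely, since at ties that rule is not a probability vector. *)

theory Defs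
  imports "HOL-Probability.Probability"
begin

definition prob_vectors :: "(real^'a::finite) set" where
  "prob_vectors = {x. (\<forall>u. 0 \<le> x $ u) \<and> (\<Sum>u\<in>UNIV. x $ u) = 1}"

text \<open>The natural logarithm is used; \<open>0 log 0 = 0\<close> holds automatically.\<close>

definition KL :: "real^'a::finite \<Rightarrow> real^'a \<Rightarrow> real" where
  "KL r p = (\<Sum>u\<in>UNIV. r $ u * ln (r $ u / p $ u))"

definition measure_support :: "'b::topological_space measure \<Rightarrow> 'b set" where
  "measure_support P = {x. \<forall>U. open U \<and> x \<in> U \<longrightarrow> 0 < emeasure P U}"

text \<open>
  The law of a random vector, as a measure whose underlying space is the support of that law.
  Below, \<open>D\<close> always stands for such a measure, so functions on the support are functions
  considered on \<open>space D\<close> only, and expectations over the random vector are integrals over \<open>D\<close>.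
\<close>

definition law_on_support :: "'w measure \<Rightarrow> ('w \<Rightarrow> 'b::topological_space) \<Rightarrow> 'b measure" where
  "law_on_support M G =
     restrict_space (distr M borel G) (measure_support (distr M borel G))"

definition mean :: "(real^'a::finite) measure \<Rightarrow> (real^'a \<Rightarrow> real^'a) \<Rightarrow> real^'a" where
  "mean D q = (\<chi> u. \<integral>g. q g $ u \<partial>D)"

definition policy :: "(real^'a::finite) measure \<Rightarrow> (real^'a \<Rightarrow> real^'a) \<Rightarrow> bool" where
  "policy D q \<longleftrightarrow> q \<in> borel_measurable D \<and> (\<forall>g\<in>space D. q g \<in> prob_vectors)"

definition feasible ::
  "(real^'a::finite) measure \<Rightarrow> real^'a \<Rightarrow> real \<Rightarrow> (real^'a \<Rightarrow> real^'a) \<Rightarrow> bool" where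
  "feasible D p \<epsilon> q \<longleftrightarrow> policy D q \<and> KL (mean D q) p \<le> \<epsilon>"

definition objective :: "(real^'a::finite) measure \<Rightarrow> (real^'a \<Rightarrow> real^'a) \<Rightarrow> real" where
  "objective D q = (\<integral>g. g \<bullet> q g \<partial>D)"

definition optimal ::
  "(real^'a::finite) measure \<Rightarrow> real^'a \<Rightarrow> real \<Rightarrow> (real^'a \<Rightarrow> real^'a) \<Rightarrow> bool" where
  "optimal D p \<epsilon> q \<longleftrightarrow> is_arg_max (objective D) (feasible D p \<epsilon>) q"

definition maximizers :: "real^'a::finite \<Rightarrow> real^'a \<Rightarrow> 'a set" where
  "maximizers g \<tau> = {u. is_arg_max (\<lambda>v. g $ v + \<tau> $ v) (\<lambda>_. True) u}"

definition tie_breaking ::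
  "(real^'a::finite) measure \<Rightarrow> real^'a \<Rightarrow> (real^'a \<Rightarrow> 'a \<Rightarrow> real) \<Rightarrow> bool" where
  "tie_breaking D \<tau> T \<longleftrightarrow>
     case_prod T \<in> borel_measurable (D \<Otimes>\<^sub>M count_space UNIV) \<and>
     (\<forall>g\<in>space D. \<forall>u. T g u \<in> {0..1}) \<and>
     (\<forall>g\<in>space D. (\<Sum>u\<in>maximizers g \<tau>. T g u) = 1)"

definition threshold_policy ::
  "real^'a::finite \<Rightarrow> (real^'a \<Rightarrow> 'a \<Rightarrow> real) \<Rightarrow> real^'a \<Rightarrow> real^'a" where
  "threshold_policy \<tau> T g = (\<chi> u.
     if {u} = maximizers g \<tau> then 1
     else if u \<in> maximizers g \<tau> \<and> 1 < card (maximizers g \<tau>) then T g u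
     else 0)"

text \<open>This need not be a probability vector where the maximizer is not unique.\<close>

definition gumbel_rule :: "real \<Rightarrow> real^'a::finite \<Rightarrow> real^'a \<Rightarrow> real^'a" where
  "gumbel_rule \<alpha> p g = (\<chi> u. indicator (maximizers g (\<chi> v. \<alpha> * ln (p $ v))) u)"

lemma closed_measure_support: "closed (measure_support P)"
proof -
  have "- measure_support P = \<Union>{U. open U \<and> emeasure P U = 0}"
    by (auto simp: measure_support_def not_less)
  then show ?thesis
    by (metis (no_types, lifting) closed_def mem_Collect_eq open_Union)
qed

lemma prob_space_law_on_support:
  fixes G :: "'w \<Rightarrow> 'b::second_countable_topology"
  assumes "prob_space M" and G: "G \<in> borel_measurable M"
  shows "prob_space (law_on_support M G)"
    and "space (law_on_support M G) = measure_support (distr M borel G)"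
proof -
  let ?P = "distr M borel G"
  let ?N = "{U. open U \<and> emeasure ?P U = 0}"
  interpret P: prob_space ?P
    using assms by (intro prob_space.prob_space_distr)
  obtain C where C: "C \<subseteq> ?N" "countable C" "\<Union>C = \<Union>?N"
    using Lindelof[of ?N] by auto
  have eq: "- measure_support ?P = \<Union>C"
    unfolding C by (auto simp: measure_support_def not_less)
  have "(\<Union>U\<in>C. U) \<in> null_sets ?P"
    using C(1,2) by (intro null_sets_UN') (auto simp: null_sets_def)
  then have null: "emeasure ?P (- measure_support ?P) = 0"
    by (simp add: eq null_sets_def)
  have S: "measure_support ?P \<in> sets ?P"
    by (simp add: closed_measure_support)
  have "AE x in ?P. x \<in> measure_support ?P"
    by (rule AE_I[of _ _ "- measure_support ?P"]) (use null S in auto)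
  then have "emeasure ?P (measure_support ?P) = 1"
    using P.emeasure_eq_1_AE[OF S] by simp
  then show "prob_space (law_on_support M G)"
    unfolding law_on_support_def using S by (intro prob_space_restrict_space)
  show "space (law_on_support M G) = measure_support ?P"
    by (simp add: law_on_support_def space_restrict_space)
qed

end

(* The problem is solved through its Lagrangian dual in the mean r = E[q(G)]. Let K be the KL ball
   inside the simplex and minimise h(t) = E[max_v (G_v + t_v)] - min_{r in K} t.r. The function h is
   invariant under adding constants to t and, because the full-support vector p lies in K, coercive
   modulo constants, so a minimiser t exists. The means of the policies supported on M(G,t)
   contain the convex hull of the finitely many means of deterministic tie-breakings that depend
   only on the set M(G,t). If this compact convex set missed the face of K minimising t.r, a
   separating direction would be a descent direction for h. A common point yields a threshold
   policy that is optimal by weak duality. If its KL constraint were slack, mixing in an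
   unconstrained maximiser would improve it unless it is itself supported on M(G,0).

   For Gumbel coordinates M(G,t) has mean softmax t, so the candidates for t = alpha log p form the
   exponential family p^alpha; alpha comes from the intermediate value theorem and optimality from
   Gibbs' inequality. *)
theory Submission
  imports Defs "HOL-Real_Asymp.Real_Asymp"
begin

section \<open>Relative entropy\<close>

text \<open>This is ln y \<le> y - 1 at y = z/x, multiplied by x. Over two probability vectors the
  linear lower bounds sum to zero, which gives Gibbs' inequality.\<close>

lemma mul_ln_div_ge:
  fixes x z :: real
  assumes "0 \<le> x" "0 < z"
  shows "x - z \<le> x * ln (x / z)"
proof (cases "x = 0")
  case False
  with assms have "ln (z / x) \<le> z / x - 1"
    by (intro ln_le_minus_one) auto
  then have "x * ln (z / x) \<le> x * (z / x - 1)"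
    using assms by (intro mult_left_mono)
  then show ?thesis
    using assms False by (simp add: ln_div algebra_simps)
qed (use assms in simp)

text \<open>The bound ln y \<le> y - 1 is tight only at y = 1; x = 0 is excluded because it would
  force z = 0.\<close>

lemma mul_ln_div_eq_imp_eq:
  fixes x z :: real
  assumes "0 \<le> x" "0 < z" and eq: "x * ln (x / z) = x - z"
  shows "x = z"
proof -
  have "x \<noteq> 0"
    using assms by auto
  then have "0 < x"
    using assms by simp
  have "x * ln (z / x) = x * (z / x - 1)"
    using eq \<open>0 < x\<close> \<open>0 < z\<close> by (simp add: ln_div algebra_simps)
  then have "ln (z / x) = z / x - 1"
    using \<open>0 < x\<close> by simp
  then have "z / x = 1"
    using ln_eq_minus_one[of "z / x"] \<open>0 < x\<close> \<open>0 < z\<close> by simp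
  then show ?thesis
    using \<open>0 < x\<close> by simp
qed

text \<open>Inserts an intermediate reference y. At x = 0 the logarithms do not add up, but the
  factor x kills every term.\<close>

lemma mul_ln_div_split:
  fixes x y z :: real
  assumes "0 \<le> x" "0 < y" "0 < z"
  shows "x * ln (x / z) = x * ln (x / y) + x * ln (y / z)"
  using assms by (cases "x = 0") (simp_all add: ln_div algebra_simps)

lemma continuous_on_mul_ln: "continuous_on {0..} (\<lambda>x::real. x * ln x)"
  unfolding continuous_on_eq_continuous_within
proof
  fix x :: real
  assume "x \<in> {0..}"
  show "continuous (at x within {0..}) (\<lambda>x. x * ln x)"
  proof (cases "x = 0")
    case True
    \<comment> \<open>The limit at the endpoint agrees with the value there, since
      \<open>0 * ln 0\<close> evaluates to 0.\<close>
    have "((\<lambda>x::real. x * ln x) \<longlongrightarrow> 0) (at_right 0)"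
      by real_asymp
    moreover have "at x within {0..} = at_right 0"
      using True by (simp add: at_within_Ici_at_right)
    ultimately show ?thesis
      unfolding continuous_within using True by simp
  next
    case False
    with \<open>x \<in> {0..}\<close> show ?thesis
      by (intro continuous_intros) auto
  qed
qed

lemma KL_nonneg:
  assumes "r \<in> prob_vectors" "z \<in> prob_vectors" "\<forall>u. 0 < z $ u"
  shows "0 \<le> KL r z"
proof -
  have "(\<Sum>u\<in>UNIV. r $ u - z $ u) \<le> KL r z"
    unfolding KL_def using assms
    by (intro sum_mono mul_ln_div_ge) (auto simp: prob_vectors_def)
  then show ?thesis
    using assms by (simp add: prob_vectors_def sum_subtractf)
qed

text \<open>Between probability vectors, KL is the sum of the nonnegative excesses in the tangent
  bound, so each excess vanishes.\<close>

lemma KL_eq_0_imp_eq: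
  assumes "r \<in> prob_vectors" "z \<in> prob_vectors" "\<forall>u. 0 < z $ u" "KL r z = 0"
  shows "r = z"
proof -
  have "(\<Sum>u\<in>UNIV. r $ u * ln (r $ u / z $ u) - (r $ u - z $ u)) = 0"
    using assms by (simp add: KL_def prob_vectors_def sum_subtractf)
  moreover have "0 \<le> r $ u * ln (r $ u / z $ u) - (r $ u - z $ u)" for u
    using mul_ln_div_ge[of "r $ u" "z $ u"] assms by (simp add: prob_vectors_def)
  ultimately have "r $ u * ln (r $ u / z $ u) - (r $ u - z $ u) = 0" for u
    using sum_nonneg_eq_0_iff[of UNIV "\<lambda>u. r $ u * ln (r $ u / z $ u) - (r $ u - z $ u)"] by simp
  then have "r $ u = z $ u" for u
    using mul_ln_div_eq_imp_eq[of "r $ u" "z $ u"] assms(1,3) by (simp add: prob_vectors_def)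
  then show ?thesis
    by (simp add: vec_eq_iff)
qed

lemma KL_self [simp]: "KL r r = 0"
proof -
  have "r $ u * ln (r $ u / r $ u) = 0" for u
    by (cases "r $ u = 0") auto
  then show ?thesis
    by (simp only: KL_def sum.neutral_const)
qed

lemma KL_change_reference:
  assumes "r \<in> prob_vectors" "\<forall>u. 0 < y $ u" "\<forall>u. 0 < z $ u"
  shows "KL r z = KL r y + (\<Sum>u\<in>UNIV. r $ u * ln (y $ u / z $ u))"
  unfolding KL_def sum.distrib[symmetric] using assms
  by (intro sum.cong mul_ln_div_split) (auto simp: prob_vectors_def)

text \<open>Convexity holds coordinate by coordinate, by comparing both arguments with their
  mixture.\<close>

lemma KL_convex:
  assumes r: "r \<in> prob_vectors" and s: "s \<in> prob_vectors" and z: "\<forall>u. 0 < z $ u"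
    and ab: "0 \<le> a" "0 \<le> b" "a + b = 1"
  shows "KL (a *\<^sub>R r + b *\<^sub>R s) z \<le> a * KL r z + b * KL s z"
proof -
  have "(a * x + b * y) * ln ((a * x + b * y) / w) \<le> a * (x * ln (x / w)) + b * (y * ln (y / w))"
    if "0 \<le> x" "0 \<le> y" "0 < w" for x y w :: real
  proof (cases "a * x + b * y = 0")
    case True
    then have "a * x = 0" "b * y = 0"
      using that ab by (auto simp: add_nonneg_eq_0_iff)
    then show ?thesis
      by auto
  next
    case False
    \<comment> \<open>The mixture t is a common reference: the weighted tangent bounds at t cancel,
      and passing from t to w contributes exactly t ln (t/w).\<close>
    define t where "t = a * x + b * y"
    have "0 < t"
      using False that ab by (simp add: t_def order_less_le)
    have "a * (x - t) \<le> a * (x * ln (x / t))" "b * (y - t) \<le> b * (y * ln (y / t))"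
      using that ab \<open>0 < t\<close> by (intro mult_left_mono mul_ln_div_ge; simp)+
    moreover have "a * (x - t) + b * (y - t) = 0"
      unfolding t_def using ab(3) by algebra
    ultimately have "0 \<le> a * (x * ln (x / t)) + b * (y * ln (y / t))"
      by linarith
    moreover have "x * ln (x / w) = x * ln (x / t) + x * ln (t / w)"
      "y * ln (y / w) = y * ln (y / t) + y * ln (t / w)"
      using that \<open>0 < t\<close> by (auto intro: mul_ln_div_split)
    ultimately show ?thesis
      unfolding t_def[symmetric] by (simp add: t_def algebra_simps)
  qed
  then have "KL (a *\<^sub>R r + b *\<^sub>R s) z
      \<le> (\<Sum>u\<in>UNIV. a * (r $ u * ln (r $ u / z $ u)) + b * (s $ u * ln (s $ u / z $ u)))"
    unfolding KL_def using r s z by (intro sum_mono) (auto simp: prob_vectors_def)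
  then show ?thesis
    by (simp add: KL_def sum.distrib sum_distrib_left)
qed

text \<open>Splitting x ln (x/y) into x ln x - x ln y is valid even at x = 0, so continuity up to
  the boundary of the simplex reduces to that of x ln x.\<close>

lemma continuous_on_KL:
  assumes "\<forall>u. 0 < z $ u"
  shows "continuous_on prob_vectors (\<lambda>r. KL r z)"
proof -
  have "continuous_on prob_vectors (\<lambda>r. \<Sum>u\<in>UNIV. r $ u * ln (r $ u) - r $ u * ln (z $ u))"
    by (intro continuous_intros continuous_on_compose2[OF continuous_on_mul_ln])
      (auto simp: prob_vectors_def)
  moreover have "x * ln (x / y) = x * ln x - x * ln y" if "0 \<le> x" "0 < y" for x y :: real
    using that by (cases "x = 0") (simp_all add: ln_div algebra_simps)
  ultimately show ?thesis
    unfolding KL_def using assms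
    by (auto simp: prob_vectors_def cong: continuous_on_cong_simp)
qed

section \<open>Compactness and convexity of the simplex and of KL balls\<close>

lemma convex_prob_vectors: "convex prob_vectors"
proof (rule convexI)
  fix x y :: "real^'a" and a b :: real
  assume "x \<in> prob_vectors" "y \<in> prob_vectors" "0 \<le> a" "0 \<le> b" "a + b = 1"
  then show "a *\<^sub>R x + b *\<^sub>R y \<in> prob_vectors"
    by (simp add: prob_vectors_def sum.distrib flip: sum_distrib_left)
qed

lemma prob_vector_le_1:
  assumes "x \<in> prob_vectors"
  shows "x $ u \<le> 1"
  using assms member_le_sum[of u UNIV "\<lambda>u. x $ u"] by (simp add: prob_vectors_def)

lemma norm_prob_vector_le_1:
  assumes "x \<in> prob_vectors"
  shows "norm x \<le> 1"
  using norm_le_l1_cart[of x] assms by (simp add: prob_vectors_def)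

lemma compact_prob_vectors: "compact prob_vectors"
proof -
  have "prob_vectors =
      (\<Inter>u. {x::real^'a. 0 \<le> x $ u}) \<inter> {x. (\<Sum>u\<in>UNIV. x $ u) = 1}"
    by (auto simp: prob_vectors_def)
  also have "closed \<dots>"
    by (intro closed_Int closed_INT ballI closed_Collect_le closed_Collect_eq continuous_intros)
  finally show ?thesis
    unfolding compact_eq_bounded_closed by (auto simp: bounded_iff intro: norm_prob_vector_le_1)
qed

lemma convex_KL_ball:
  assumes "\<forall>u. 0 < z $ u"
  shows "convex {r \<in> prob_vectors. KL r z \<le> \<epsilon>}"
proof (rule convexI)
  fix x y :: "real^'a" and a b :: real
  assume x: "x \<in> {r \<in> prob_vectors. KL r z \<le> \<epsilon>}"
    and y: "y \<in> {r \<in> prob_vectors. KL r z \<le> \<epsilon>}"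
    and ab: "0 \<le> a" "0 \<le> b" "a + b = 1"
  have "KL (a *\<^sub>R x + b *\<^sub>R y) z \<le> a * KL x z + b * KL y z"
    using x y ab assms by (intro KL_convex) auto
  also have "\<dots> \<le> \<epsilon>"
    using x y ab by (intro convex_bound_le) auto
  finally show "a *\<^sub>R x + b *\<^sub>R y \<in> {r \<in> prob_vectors. KL r z \<le> \<epsilon>}"
    using x y ab convexD[OF convex_prob_vectors] by auto
qed

lemma compact_KL_ball:
  assumes "\<forall>u. 0 < z $ u"
  shows "compact {r \<in> prob_vectors. KL r z \<le> \<epsilon>}"
proof -
  have "closed (prob_vectors \<inter> (\<lambda>r. KL r z) -` {..\<epsilon>})"
    using assms compact_imp_closed[OF compact_prob_vectors]
    by (intro continuous_closed_preimage continuous_on_KL) auto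
  from compact_Int_closed[OF compact_prob_vectors this] show ?thesis
    by (simp add: vimage_def Int_def conj_ac)
qed

section \<open>Policies supported on the maximizers\<close>

lemma maximizers_iff: "u \<in> maximizers g \<tau> \<longleftrightarrow> (\<forall>v. g $ v + \<tau> $ v \<le> g $ u + \<tau> $ u)"
  by (auto simp: maximizers_def is_arg_max_def not_less)

lemma maximizers_nonempty: "maximizers g \<tau> \<noteq> {}"
proof -
  have "Max (range (\<lambda>v. g $ v + \<tau> $ v)) \<in> range (\<lambda>v. g $ v + \<tau> $ v)"
    by (intro Max_in) auto
  then obtain u where u: "Max (range (\<lambda>v. g $ v + \<tau> $ v)) = g $ u + \<tau> $ u"
    by (rule rangeE)
  have "g $ v + \<tau> $ v \<le> Max (range (\<lambda>v. g $ v + \<tau> $ v))" for v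
    by (intro Max_ge) auto
  then have "u \<in> maximizers g \<tau>"
    by (simp add: maximizers_iff u del: Max_ge_iff)
  then show ?thesis
    by blast
qed

section \<open>The pointwise maximum and the probability vectors that attain it\<close>

definition max_value :: "real^'a::finite \<Rightarrow> real^'a \<Rightarrow> real" where
  "max_value g \<tau> = Max (range (\<lambda>u. g $ u + \<tau> $ u))"

lemma max_value_ge: "g $ u + \<tau> $ u \<le> max_value g \<tau>"
  by (simp add: max_value_def)

lemma max_value_maximizers: "u \<in> maximizers g \<tau> \<Longrightarrow> max_value g \<tau> = g $ u + \<tau> $ u"
  unfolding maximizers_iff max_value_def by (intro Max_eqI) auto

lemma inner_prob_vector_le_max_value:
  assumes "x \<in> prob_vectors"
  shows "(g + \<tau>) \<bullet> x \<le> max_value g \<tau>"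
proof -
  have "(\<Sum>u\<in>UNIV. (g $ u + \<tau> $ u) * x $ u) \<le> (\<Sum>u\<in>UNIV. max_value g \<tau> * x $ u)"
    using assms max_value_ge by (intro sum_mono mult_right_mono) (auto simp: prob_vectors_def)
  then show ?thesis
    using assms by (simp add: inner_vec_def prob_vectors_def flip: sum_distrib_left)
qed

text \<open>Complementary slackness: the loss against the maximum is a sum of nonnegative products
  of gap and mass, and a gap vanishes exactly at a maximizer.\<close>

lemma inner_prob_vector_eq_max_value_iff:
  assumes "x \<in> prob_vectors"
  shows "(g + \<tau>) \<bullet> x = max_value g \<tau> \<longleftrightarrow> (\<forall>u. u \<notin> maximizers g \<tau> \<longrightarrow> x $ u = 0)"
proof -
  have "max_value g \<tau> - (g + \<tau>) \<bullet> x = (\<Sum>u\<in>UNIV. (max_value g \<tau> - (g $ u + \<tau> $ u)) * x $ u)"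
    using assms by (simp add: inner_vec_def prob_vectors_def left_diff_distrib sum_subtractf
        flip: sum_distrib_left)
  moreover have "0 \<le> (max_value g \<tau> - (g $ u + \<tau> $ u)) * x $ u" for u
    using assms max_value_ge[of g u \<tau>] by (simp add: prob_vectors_def)
  then have "(\<Sum>u\<in>UNIV. (max_value g \<tau> - (g $ u + \<tau> $ u)) * x $ u) = 0 \<longleftrightarrow>
      (\<forall>u. (max_value g \<tau> - (g $ u + \<tau> $ u)) * x $ u = 0)"
    by (subst sum_nonneg_eq_0_iff) simp_all
  ultimately have "(g + \<tau>) \<bullet> x = max_value g \<tau> \<longleftrightarrow>
      (\<forall>u. (max_value g \<tau> - (g $ u + \<tau> $ u)) * x $ u = 0)"
    by (metis eq_iff_diff_eq_0)
  moreover have "max_value g \<tau> - (g $ u + \<tau> $ u) = 0 \<longleftrightarrow> u \<in> maximizers g \<tau>" for u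
  proof
    assume "max_value g \<tau> - (g $ u + \<tau> $ u) = 0"
    then have "max_value g \<tau> = g $ u + \<tau> $ u"
      by simp
    then show "u \<in> maximizers g \<tau>"
      unfolding maximizers_iff using max_value_ge[of g _ \<tau>] by simp
  qed (simp add: max_value_maximizers)
  ultimately show ?thesis
    by (simp only: mult_eq_0_iff) blast
qed

text \<open>Normalization of the weights absorbs the case of a unique maximizer, whose weight must
  be 1.\<close>

lemma threshold_policy_nth:
  assumes "(\<Sum>u\<in>maximizers g \<tau>. T g u) = 1"
  shows "threshold_policy \<tau> T g $ u = (if u \<in> maximizers g \<tau> then T g u else 0)"
proof (cases "\<exists>v. maximizers g \<tau> = {v}")
  case True
  with assms show ?thesis
    by (auto simp: threshold_policy_def)
next
  case False
  then have "card (maximizers g \<tau>) \<noteq> 1"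
    by (auto simp: card_1_singleton_iff)
  moreover have "card (maximizers g \<tau>) \<noteq> 0"
    using maximizers_nonempty by auto
  ultimately have "1 < card (maximizers g \<tau>)"
    by linarith
  with False show ?thesis
    by (auto simp: threshold_policy_def)
qed

lemma borel_measurable_vecI:
  fixes f :: "'b \<Rightarrow> real^'a::finite"
  assumes "\<And>u. (\<lambda>x. f x $ u) \<in> borel_measurable N"
  shows "f \<in> borel_measurable N"
  using assms by (subst borel_measurable_euclidean_space) (auto simp: Basis_vec_def inner_axis)

lemma borel_measurable_nth:
  fixes f :: "'b \<Rightarrow> real^'a::finite"
  assumes "f \<in> borel_measurable N"
  shows "(\<lambda>x. f x $ u) \<in> borel_measurable N"
  using measurable_compose[OF assms borel_measurable_continuous_onI[OF continuous_on_component[OF continuous_on_id]]]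
  by simp

text \<open>Threshold policies without the case distinction: the tie-breaking weights are the
  coordinates of the policy itself. Support on the maximizers is required everywhere on
  \<open>space D\<close>, as in \<open>tie_breaking\<close>.\<close>

definition greedy_policy :: "(real^'a::finite) measure \<Rightarrow> real^'a \<Rightarrow> (real^'a \<Rightarrow> real^'a) \<Rightarrow> bool" where
  "greedy_policy D \<tau> q \<longleftrightarrow>
     policy D q \<and> (\<forall>g\<in>space D. \<forall>u. u \<notin> maximizers g \<tau> \<longrightarrow> q g $ u = 0)"

text \<open>A deterministic tie-breaking that sees only the set of tied indices. There are finitely
  many such rules, and they induce measurable policies.\<close>

definition selector :: "('a set \<Rightarrow> 'a) \<Rightarrow> bool" where
  "selector f \<longleftrightarrow> (\<forall>A. A \<noteq> {} \<longrightarrow> f A \<in> A)"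

definition select :: "('a set \<Rightarrow> 'a) \<Rightarrow> real^'a::finite \<Rightarrow> real^'a \<Rightarrow> real^'a" where
  "select f \<tau> g = axis (f (maximizers g \<tau>)) 1"

lemma selector_maximizers: "selector f \<Longrightarrow> f (maximizers g \<tau>) \<in> maximizers g \<tau>"
  unfolding selector_def using maximizers_nonempty by blast

lemma selector_SOME: "selector (\<lambda>A. SOME a. a \<in> A)"
  by (auto simp: selector_def some_in_eq)

lemma inner_select: "x \<bullet> select f \<tau> g = x $ f (maximizers g \<tau>)"
  by (simp add: select_def inner_axis)

lemma axis_in_prob_vectors: "axis u 1 \<in> prob_vectors"
  by (auto simp: prob_vectors_def axis_def)

section \<open>Policies and their means under a law with integrable coordinates\<close>

locale integrable_law = prob_space D
  for D :: "(real^'a::finite) measure" +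
  assumes integrable_nth: "integrable D (\<lambda>g. g $ u)"
begin

lemma nth_measurable [measurable]: "(\<lambda>g. g $ u) \<in> borel_measurable D"
  using integrable_nth by (rule borel_measurable_integrable)

text \<open>The range is finite, and each fiber is a finite Boolean combination of comparisons
  between shifted coordinates.\<close>

lemma maximizers_measurable [measurable]:
  "(\<lambda>g. maximizers g \<tau>) \<in> measurable D (count_space UNIV)"
proof (subst measurable_count_space_eq2)
  have "(\<lambda>g. maximizers g \<tau>) -` {A} \<inter> space D =
      {g\<in>space D. \<forall>u. u \<in> A \<longleftrightarrow> (\<forall>v. g $ v + \<tau> $ v \<le> g $ u + \<tau> $ u)}" for A
    by (auto simp: set_eq_iff maximizers_iff)
  then show "(\<lambda>g. maximizers g \<tau>) \<in> space D \<rightarrow> UNIV \<and>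
      (\<forall>A\<in>UNIV. (\<lambda>g. maximizers g \<tau>) -` {A} \<inter> space D \<in> sets D)"
    by simp
qed simp

lemma policy_measurable: "policy D q \<Longrightarrow> (\<lambda>g. q g $ u) \<in> borel_measurable D"
  by (auto simp: policy_def intro: borel_measurable_nth)

lemma policy_integrable_nth:
  assumes "policy D q"
  shows "integrable D (\<lambda>g. q g $ u)"
proof (rule integrable_const_bound[where B = 1])
  show "AE g in D. norm (q g $ u) \<le> 1"
    using assms prob_vector_le_1 by (intro AE_I2) (auto simp: policy_def prob_vectors_def)
qed (rule policy_measurable[OF assms])

lemma policy_integrable_inner:
  assumes "policy D q"
  shows "integrable D (\<lambda>g. \<tau> \<bullet> q g)"
  unfolding inner_vec_def using policy_integrable_nth[OF assms] by simp

lemma policy_integrable_reward: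
  assumes "policy D q"
  shows "integrable D (\<lambda>g. g \<bullet> q g)"
proof -
  have "integrable D (\<lambda>g. g $ u * q g $ u)" for u
  proof (rule Bochner_Integration.integrable_bound[OF integrable_nth[of u]])
    show "(\<lambda>g. g $ u * q g $ u) \<in> borel_measurable D"
      using policy_measurable[OF assms] by measurable
    have "norm (g $ u * q g $ u) \<le> norm (g $ u)" if "g \<in> space D" for g
      using assms that prob_vector_le_1[of "q g" u]
      by (auto simp: policy_def prob_vectors_def abs_mult intro!: mult_left_le)
    then show "AE g in D. norm (g $ u * q g $ u) \<le> norm (g $ u)"
      by (rule AE_I2)
  qed
  then show ?thesis
    by (simp add: inner_vec_def)
qed

lemma integral_inner_policy:
  assumes "policy D q"
  shows "(\<integral>g. \<tau> \<bullet> q g \<partial>D) = \<tau> \<bullet> mean D q"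
  unfolding inner_vec_def mean_def using policy_integrable_nth[OF assms] by simp

lemma integral_shifted_reward:
  assumes "policy D q"
  shows "(\<integral>g. (g + \<tau>) \<bullet> q g \<partial>D) = objective D q + \<tau> \<bullet> mean D q"
  unfolding inner_add_left objective_def
  using policy_integrable_reward[OF assms] policy_integrable_inner[OF assms]
  by (simp add: integral_inner_policy[OF assms])

lemma mean_in_prob_vectors:
  assumes "policy D q"
  shows "mean D q \<in> prob_vectors"
proof -
  have "(\<Sum>u\<in>UNIV. mean D q $ u) = (\<integral>g. (\<Sum>u\<in>UNIV. q g $ u) \<partial>D)"
    using policy_integrable_nth[OF assms] by (simp add: mean_def)
  also have "\<dots> = (\<integral>g. 1 \<partial>D)"
    using assms by (intro Bochner_Integration.integral_cong) (auto simp: policy_def prob_vectors_def)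
  finally have "(\<Sum>u\<in>UNIV. mean D q $ u) = 1"
    by (simp add: prob_space)
  moreover have "0 \<le> mean D q $ u" for u
    using assms by (auto simp: mean_def policy_def prob_vectors_def intro!: integral_nonneg_AE)
  ultimately show ?thesis
    by (simp add: prob_vectors_def)
qed

lemma mean_cong_AE:
  assumes "policy D q" "policy D q'" "AE g in D. q g = q' g"
  shows "mean D q = mean D q'"
  using assms by (auto simp: mean_def vec_eq_iff policy_measurable intro!: integral_cong_AE)

lemma policy_convex_combination:
  assumes "policy D q" "policy D q'" "0 \<le> a" "0 \<le> b" "a + b = 1"
  shows "policy D (\<lambda>g. a *\<^sub>R q g + b *\<^sub>R q' g)"
  unfolding policy_def
proof (intro conjI ballI)
  show "(\<lambda>g. a *\<^sub>R q g + b *\<^sub>R q' g) \<in> borel_measurable D"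
    using assms
    by (auto simp: policy_def intro!: borel_measurable_add borel_measurable_scaleR measurable_const)
  show "a *\<^sub>R q g + b *\<^sub>R q' g \<in> prob_vectors" if "g \<in> space D" for g
    using assms that by (intro convexD[OF convex_prob_vectors]) (auto simp: policy_def)
qed

lemma mean_convex_combination:
  assumes "policy D q" "policy D q'"
  shows "mean D (\<lambda>g. a *\<^sub>R q g + b *\<^sub>R q' g) = a *\<^sub>R mean D q + b *\<^sub>R mean D q'"
  using policy_integrable_nth[OF assms(1)] policy_integrable_nth[OF assms(2)]
  by (simp add: mean_def vec_eq_iff)

lemma objective_convex_combination:
  assumes "policy D q" "policy D q'"
  shows "objective D (\<lambda>g. a *\<^sub>R q g + b *\<^sub>R q' g) = a * objective D q + b * objective D q'"
  using policy_integrable_reward[OF assms(1)] policy_integrable_reward[OF assms(2)]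
  by (simp add: objective_def inner_add_right)

text \<open>Mixing preserves support on the maximizers, and the mean is affine in the policy. Hence
  randomizing over selectors stays within the greedy policies.\<close>

lemma convex_greedy_means: "convex {mean D q |q. greedy_policy D \<tau> q}"
proof (rule convexI)
  fix x y and a b :: real
  assume "x \<in> {mean D q |q. greedy_policy D \<tau> q}" "y \<in> {mean D q |q. greedy_policy D \<tau> q}"
    and ab: "0 \<le> a" "0 \<le> b" "a + b = 1"
  then obtain q q' where q: "x = mean D q" "y = mean D q'" "greedy_policy D \<tau> q" "greedy_policy D \<tau> q'"
    by blast
  then have "greedy_policy D \<tau> (\<lambda>g. a *\<^sub>R q g + b *\<^sub>R q' g)"
    using ab by (simp add: greedy_policy_def policy_convex_combination)
  moreover have "mean D (\<lambda>g. a *\<^sub>R q g + b *\<^sub>R q' g) = a *\<^sub>R x + b *\<^sub>R y"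
    using q by (simp add: greedy_policy_def mean_convex_combination)
  ultimately show "a *\<^sub>R x + b *\<^sub>R y \<in> {mean D q |q. greedy_policy D \<tau> q}"
    by (metis (mono_tags, lifting) mem_Collect_eq)
qed

lemma greedy_select:
  assumes "selector f"
  shows "greedy_policy D \<tau> (select f \<tau>)"
proof -
  have "(\<lambda>g. axis (f (maximizers g \<tau>)) 1) \<in> measurable D borel"
    by (rule measurable_compose[OF maximizers_measurable]) simp
  then have "policy D (select f \<tau>)"
    by (simp add: policy_def select_def[abs_def] axis_in_prob_vectors)
  then show ?thesis
    using selector_maximizers[OF assms] by (auto simp: greedy_policy_def select_def axis_def)
qed

lemma greedy_threshold_policy:
  assumes T: "tie_breaking D \<tau> T"
  shows "greedy_policy D \<tau> (threshold_policy \<tau> T)"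
proof -
  have eq: "threshold_policy \<tau> T g $ u = (if u \<in> maximizers g \<tau> then T g u else 0)"
    if "g \<in> space D" for g u
    using T that by (simp add: tie_breaking_def threshold_policy_nth)
  have [measurable]: "(\<lambda>g. T g u) \<in> borel_measurable D" for u
  proof -
    have "(\<lambda>g. case_prod T (g, u)) \<in> borel_measurable D"
      using T by (intro measurable_compose[OF measurable_Pair2']) (auto simp: tie_breaking_def)
    then show ?thesis
      by simp
  qed
  have "(\<lambda>g. if u \<in> maximizers g \<tau> then T g u else 0) \<in> borel_measurable D" for u
    by measurable
  then have "threshold_policy \<tau> T \<in> borel_measurable D"
    by (intro borel_measurable_vecI) (simp add: eq cong: measurable_cong)
  moreover have "threshold_policy \<tau> T g \<in> prob_vectors" if "g \<in> space D" for g
    using T that by (auto simp: prob_vectors_def eq tie_breaking_def sum.If_cases)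
  ultimately show ?thesis
    by (auto simp: greedy_policy_def policy_def eq)
qed

text \<open>Converse of \<open>greedy_threshold_policy\<close>: the coordinates of a greedy policy
  serve as its tie-breaking weights.\<close>

lemma greedy_policy_tie_breaking:
  assumes q: "greedy_policy D \<tau> q"
  shows "tie_breaking D \<tau> (\<lambda>g u. q g $ u)"
    and "g \<in> space D \<Longrightarrow> threshold_policy \<tau> (\<lambda>g u. q g $ u) g = q g"
proof -
  have q': "policy D q" "q g \<in> prob_vectors" "\<And>u. u \<notin> maximizers g \<tau> \<Longrightarrow> q g $ u = 0"
    if "g \<in> space D" for g
    using q that by (auto simp: greedy_policy_def policy_def)
  have sum: "(\<Sum>u\<in>maximizers g \<tau>. q g $ u) = 1" if "g \<in> space D" for g
  proof -
    have "(\<Sum>u\<in>maximizers g \<tau>. q g $ u) = (\<Sum>u\<in>UNIV. q g $ u)"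
      using q'(3)[OF that] by (intro sum.mono_neutral_left) auto
    then show ?thesis
      using q'(2)[OF that] by (simp add: prob_vectors_def)
  qed
  \<comment> \<open>Joint measurability follows from that of each coordinate because the index
    factor is countable; the two factors are swapped afterwards.\<close>
  have "(\<lambda>(u, g). q g $ u) \<in> borel_measurable (count_space UNIV \<Otimes>\<^sub>M D)"
    using q by (intro measurable_pair_measure_countable1) (auto simp: greedy_policy_def policy_measurable)
  from measurable_compose[OF measurable_pair_swap' this]
  have "(\<lambda>(g, u). q g $ u) \<in> borel_measurable (D \<Otimes>\<^sub>M count_space UNIV)"
    by (simp add: case_prod_unfold)
  then show "tie_breaking D \<tau> (\<lambda>g u. q g $ u)"
    using q'(2) prob_vector_le_1[OF q'(2)] sum by (auto simp: tie_breaking_def prob_vectors_def)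
  show "threshold_policy \<tau> (\<lambda>g u. q g $ u) g = q g" if "g \<in> space D"
    using q'(3)[OF that] sum[OF that] by (auto simp: vec_eq_iff threshold_policy_nth)
qed

text \<open>Turns almost sure support on the maximizers into support everywhere, by using a selector
  on the exceptional null set.\<close>

lemma greedy_modification:
  assumes q: "policy D q" and AE: "AE g in D. \<forall>u. u \<notin> maximizers g \<tau> \<longrightarrow> q g $ u = 0"
  obtains q' where "greedy_policy D \<tau> q'" "AE g in D. q' g = q g"
proof -
  define s where "s = select (\<lambda>A. SOME a. a \<in> A) \<tau>"
  have s: "greedy_policy D \<tau> s"
    unfolding s_def by (intro greedy_select selector_SOME)
  define q' where "q' g = (if \<forall>u. u \<notin> maximizers g \<tau> \<longrightarrow> q g $ u = 0 then q g else s g)" for g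
  have [measurable]: "q \<in> borel_measurable D" "s \<in> borel_measurable D"
    using q s by (auto simp: policy_def greedy_policy_def)
  note [measurable] = policy_measurable[OF q]
  have "q' \<in> borel_measurable D"
    unfolding q'_def by measurable
  then have "greedy_policy D \<tau> q'"
    using q s by (auto simp: greedy_policy_def policy_def q'_def)
  moreover have "AE g in D. q' g = q g"
    using AE by (auto simp: q'_def)
  ultimately show ?thesis
    by (rule that)
qed

section \<open>Weak duality and its equality case\<close>

definition expected_max :: "real^'a \<Rightarrow> real" where
  "expected_max \<tau> = (\<integral>g. max_value g \<tau> \<partial>D)"

lemma greedy_reward:
  "\<lbrakk>greedy_policy D \<tau> q; g \<in> space D\<rbrakk> \<Longrightarrow> (g + \<tau>) \<bullet> q g = max_value g \<tau>"
  by (auto simp: greedy_policy_def policy_def inner_prob_vector_eq_max_value_iff)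

lemma integrable_shifted_reward: "policy D q \<Longrightarrow> integrable D (\<lambda>g. (g + \<tau>) \<bullet> q g)"
  unfolding inner_add_left by (simp add: policy_integrable_reward policy_integrable_inner)

text \<open>The maximum is the shifted reward of a greedy policy, and rewards of policies are
  integrable.\<close>

lemma integrable_max_value: "integrable D (\<lambda>g. max_value g \<tau>)"
proof -
  have "greedy_policy D \<tau> (select (\<lambda>A. SOME a. a \<in> A) \<tau>)"
    by (intro greedy_select selector_SOME)
  from integrable_shifted_reward[of "select (\<lambda>A. SOME a. a \<in> A) \<tau>" \<tau>] greedy_reward[OF this] this
  show ?thesis
    by (simp add: greedy_policy_def cong: Bochner_Integration.integrable_cong)
qed

text \<open>Integrates the pointwise bound of a weighted average by the maximum.\<close>

lemma objective_le_expected_max: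
  assumes "policy D q"
  shows "objective D q + \<tau> \<bullet> mean D q \<le> expected_max \<tau>"
  unfolding expected_max_def integral_shifted_reward[OF assms, symmetric]
  using assms integrable_shifted_reward[OF assms] integrable_max_value
  by (intro integral_mono) (auto simp: policy_def inner_prob_vector_le_max_value)

lemma objective_greedy:
  assumes "greedy_policy D \<tau> q"
  shows "objective D q + \<tau> \<bullet> mean D q = expected_max \<tau>"
proof -
  have "policy D q"
    using assms by (simp add: greedy_policy_def)
  then show ?thesis
    unfolding expected_max_def using greedy_reward[OF assms]
    by (simp add: integral_shifted_reward[symmetric] cong: Bochner_Integration.integral_cong)
qed

text \<open>The gap in weak duality is the integral of a nonnegative function, so a zero gap makes
  it vanish almost surely; slackness then locates the mass.\<close>

lemma objective_eq_expected_max_imp_AE: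
  assumes q: "policy D q" and eq: "objective D q + \<tau> \<bullet> mean D q = expected_max \<tau>"
  shows "AE g in D. \<forall>u. u \<notin> maximizers g \<tau> \<longrightarrow> q g $ u = 0"
proof -
  have "AE g in D. max_value g \<tau> - (g + \<tau>) \<bullet> q g = 0"
  proof (rule integral_nonneg_eq_0_iff_AE[THEN iffD1])
    show "integrable D (\<lambda>g. max_value g \<tau> - (g + \<tau>) \<bullet> q g)"
      by (intro Bochner_Integration.integrable_diff integrable_max_value integrable_shifted_reward q)
    show "AE g in D. 0 \<le> max_value g \<tau> - (g + \<tau>) \<bullet> q g"
      using q by (auto simp: policy_def inner_prob_vector_le_max_value)
    show "(\<integral>g. max_value g \<tau> - (g + \<tau>) \<bullet> q g \<partial>D) = 0"
      using eq by (simp add: integrable_max_value integrable_shifted_reward q integral_shifted_reward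
          expected_max_def)
  qed
  then show ?thesis
  proof (rule AE_mp, intro AE_I2 impI)
    fix g assume "g \<in> space D" "max_value g \<tau> - (g + \<tau>) \<bullet> q g = 0"
    with q show "\<forall>u. u \<notin> maximizers g \<tau> \<longrightarrow> q g $ u = 0"
      using inner_prob_vector_eq_max_value_iff[of "q g" g \<tau>] by (simp add: policy_def)
  qed
qed

text \<open>Optimality certificate: a feasible policy gains at most
  \<open>expected_max \<tau>\<close> minus \<tau> times its mean. A greedy policy attains this
  value, and the third hypothesis makes its subtracted term the smallest.\<close>

lemma optimalI:
  assumes q: "greedy_policy D \<tau> q" and feas: "KL (mean D q) p \<le> \<epsilon>"
    and min: "\<And>r. \<lbrakk>r \<in> prob_vectors; KL r p \<le> \<epsilon>\<rbrakk> \<Longrightarrow> \<tau> \<bullet> mean D q \<le> \<tau> \<bullet> r"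
  shows "optimal D p \<epsilon> q"
proof -
  have "objective D q' \<le> objective D q" if "feasible D p \<epsilon> q'" for q'
    using that objective_le_expected_max[of q' \<tau>] objective_greedy[OF q]
      min[OF mean_in_prob_vectors, of q'] by (simp add: feasible_def)
  then show ?thesis
    using q feas by (auto simp: optimal_def is_arg_max_def feasible_def greedy_policy_def not_less)
qed

end

section \<open>Duality\<close>

text \<open>The negative of the support function of K at -\<tau>; it is the contribution of the mean
  constraint to the dual.\<close>

definition min_inner :: "(real^'a::finite) set \<Rightarrow> real^'a \<Rightarrow> real" where
  "min_inner K \<tau> = (INF r\<in>K. \<tau> \<bullet> r)"

lemma min_inner_attained:
  assumes "compact K" "K \<noteq> {}"
  obtains r where "r \<in> K" "min_inner K \<tau> = \<tau> \<bullet> r"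
proof -
  obtain r where r: "r \<in> K" "\<And>s. s \<in> K \<Longrightarrow> \<tau> \<bullet> r \<le> \<tau> \<bullet> s"
    using continuous_attains_inf[OF assms continuous_on_inner[OF continuous_on_const continuous_on_id]]
    by blast
  then have "min_inner K \<tau> = \<tau> \<bullet> r"
    unfolding min_inner_def by (intro cInf_eq_minimum) auto
  with r(1) show ?thesis
    by (rule that)
qed

lemma min_inner_le:
  assumes "compact K" "s \<in> K"
  shows "min_inner K \<tau> \<le> \<tau> \<bullet> s"
proof -
  have "compact ((\<lambda>r. \<tau> \<bullet> r) ` K)"
    using assms by (intro compact_continuous_image continuous_intros)
  then show ?thesis
    unfolding min_inner_def using assms
    by (intro cINF_lower bounded_imp_bdd_below compact_imp_bounded)
qed

text \<open>Elements of K have total mass 1, so a constant shift adds c to every inner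
  product.\<close>

lemma min_inner_shift:
  assumes "compact K" "K \<noteq> {}" "K \<subseteq> prob_vectors"
  shows "min_inner K (\<tau> + (\<chi> u. c)) = min_inner K \<tau> + c"
proof -
  have shift: "(\<tau> + (\<chi> u. c)) \<bullet> r = \<tau> \<bullet> r + c" if "r \<in> K" for r
  proof -
    have "(\<chi> u. c) \<bullet> r = c * (\<Sum>u\<in>UNIV. r $ u)"
      by (simp add: inner_vec_def sum_distrib_left)
    then show ?thesis
      using that assms(3) by (auto simp: inner_add_left prob_vectors_def)
  qed
  obtain r where r: "r \<in> K" "min_inner K \<tau> = \<tau> \<bullet> r"
    using min_inner_attained[OF assms(1,2)] .
  obtain s where s: "s \<in> K" "min_inner K (\<tau> + (\<chi> u. c)) = (\<tau> + (\<chi> u. c)) \<bullet> s"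
    using min_inner_attained[OF assms(1,2)] .
  show ?thesis
    using min_inner_le[OF assms(1) r(1), of "\<tau> + (\<chi> u. c)"] min_inner_le[OF assms(1) s(1), of \<tau>]
      shift r s by simp
qed

text \<open>It is 1-Lipschitz, because probability vectors have norm at most 1: a minimizer for one
  argument is tested at the other.\<close>

lemma continuous_on_min_inner:
  assumes "compact K" "K \<noteq> {}" "K \<subseteq> prob_vectors"
  shows "continuous_on UNIV (min_inner K)"
proof (rule lipschitz_on_continuous_on[where L = 1], rule lipschitz_onI)
  have le: "min_inner K \<tau> \<le> min_inner K \<sigma> + norm (\<tau> - \<sigma>)" for \<tau> \<sigma> :: "real^'a"
  proof -
    obtain s where s: "s \<in> K" "min_inner K \<sigma> = \<sigma> \<bullet> s"
      using min_inner_attained[OF assms(1,2)] .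
    have "(\<tau> - \<sigma>) \<bullet> s \<le> norm (\<tau> - \<sigma>) * norm s"
      by (rule norm_cauchy_schwarz)
    also have "\<dots> \<le> norm (\<tau> - \<sigma>)"
      using s(1) assms(3) norm_prob_vector_le_1 by (intro mult_left_le) auto
    finally show ?thesis
      using min_inner_le[OF assms(1) s(1), of \<tau>] s(2) by (simp add: inner_diff_left)
  qed
  show "dist (min_inner K \<tau>) (min_inner K \<sigma>) \<le> 1 * dist \<tau> \<sigma>" for \<tau> \<sigma>
    using le[of \<tau> \<sigma>] le[of \<sigma> \<tau>] by (simp add: dist_real_def dist_norm norm_minus_commute abs_le_iff)
qed simp

section \<open>Dual minimizers: existence and first-order condition\<close>

context integrable_law
begin

lemma expected_max_ge: "(\<integral>g. g $ u \<partial>D) + \<tau> $ u \<le> expected_max \<tau>"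
proof -
  have "(\<integral>g. g $ u + \<tau> $ u \<partial>D) \<le> expected_max \<tau>"
    unfolding expected_max_def
    by (intro integral_mono integrable_max_value max_value_ge Bochner_Integration.integrable_add
        integrable_nth integrable_const)
  then show ?thesis
    using integrable_nth by (simp add: prob_space)
qed

lemma expected_max_le:
  assumes "\<And>u. \<tau> $ u \<le> \<sigma> $ u + c"
  shows "expected_max \<tau> \<le> expected_max \<sigma> + c"
proof -
  have "max_value g \<tau> \<le> max_value g \<sigma> + c" for g
  proof -
    obtain u where "u \<in> maximizers g \<tau>"
      using maximizers_nonempty by blast
    then show ?thesis
      using max_value_maximizers[of u g \<tau>] max_value_ge[of g u \<sigma>] assms[of u] by linarith
  qed
  then have "expected_max \<tau> \<le> (\<integral>g. max_value g \<sigma> + c \<partial>D)"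
    unfolding expected_max_def
    by (intro integral_mono integrable_max_value Bochner_Integration.integrable_add integrable_const)
  then show ?thesis
    using integrable_max_value by (simp add: expected_max_def prob_space)
qed

lemma expected_max_shift: "expected_max (\<tau> + (\<chi> u. c)) = expected_max \<tau> + c"
  using expected_max_le[of "\<tau> + (\<chi> u. c)" \<tau> c] expected_max_le[of \<tau> "\<tau> + (\<chi> u. c)" "- c"] by simp

lemma continuous_on_expected_max: "continuous_on UNIV expected_max"
proof (rule lipschitz_on_continuous_on[where L = 1], rule lipschitz_onI)
  have le: "expected_max \<tau> \<le> expected_max \<sigma> + norm (\<tau> - \<sigma>)" for \<tau> \<sigma>
  proof (rule expected_max_le)
    show "\<tau> $ u \<le> \<sigma> $ u + norm (\<tau> - \<sigma>)" for u
      using component_le_norm_cart[of "\<tau> - \<sigma>" u] by simp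
  qed
  show "dist (expected_max \<tau>) (expected_max \<sigma>) \<le> 1 * dist \<tau> \<sigma>" for \<tau> \<sigma>
    using le[of \<tau> \<sigma>] le[of \<sigma> \<tau>] by (simp add: dist_real_def dist_norm norm_minus_commute abs_le_iff)
qed simp

text \<open>Shift invariance lets the largest coordinate be 0. A very negative coordinate then makes
  \<sigma> times p very negative, as p has full support, while \<open>expected_max\<close> stays
  bounded below. Only a compact box remains.\<close>

lemma dual_minimizer_exists:
  assumes K: "compact K" "K \<subseteq> prob_vectors" and p: "p \<in> K" "\<And>u. 0 < p $ u"
  shows "\<exists>\<tau>. \<forall>\<sigma>. expected_max \<tau> - min_inner K \<tau> \<le> expected_max \<sigma> - min_inner K \<sigma>"
proof -
  define h where "h \<tau> = expected_max \<tau> - min_inner K \<tau>" for \<tau>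
  have "K \<noteq> {}"
    using p by auto
  have h_shift: "h (\<tau> + (\<chi> u. c)) = h \<tau>" for \<tau> c
    unfolding h_def expected_max_shift min_inner_shift[OF K(1) \<open>K \<noteq> {}\<close> K(2)] by simp
  \<comment> \<open>One constant bounds the dual value at 0 from above and, negated, all coordinate
    means from below.\<close>
  define c where "c = \<bar>expected_max 0\<bar> + (\<Sum>u\<in>UNIV. \<bar>\<integral>g. g $ u \<partial>D\<bar>)"
  have c: "expected_max 0 \<le> c" "- c \<le> (\<integral>g. g $ u \<partial>D)" for u
  proof -
    have "0 \<le> (\<Sum>u\<in>UNIV. \<bar>\<integral>g. g $ u \<partial>D\<bar>)" "\<bar>\<integral>g. g $ u \<partial>D\<bar> \<le> (\<Sum>u\<in>UNIV. \<bar>\<integral>g. g $ u \<partial>D\<bar>)"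
      by (auto intro: sum_nonneg member_le_sum)
    then show "expected_max 0 \<le> c" "- c \<le> (\<integral>g. g $ u \<partial>D)"
      unfolding c_def by linarith+
  qed
  have "min_inner K 0 = 0"
    using min_inner_attained[OF K(1) \<open>K \<noteq> {}\<close>] by (metis inner_zero_left)
  then have h0: "h 0 \<le> c"
    using c by (simp add: h_def)
  define m where "m = Min (range (\<lambda>u. p $ u))"
  have m: "0 < m" "m \<le> p $ u" for u
    using p(2) by (auto simp: m_def)
  have "0 \<le> c"
    unfolding c_def by (intro add_nonneg_nonneg sum_nonneg) auto
  \<comment> \<open>Chosen so that R m = 2c: outside the box the dual value is at least -c + 2c = c,
    hence at least its value at 0.\<close>
  define R where "R = 2 * c / m"
  have R: "0 \<le> R" "R * m = 2 * c"
    using m \<open>0 \<le> c\<close> by (auto simp: R_def)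
  define B where "B = cbox (\<chi> u::'a. - R) 0"
  have B: "\<tau> \<in> B \<longleftrightarrow> (\<forall>u. - R \<le> \<tau> $ u \<and> \<tau> $ u \<le> 0)" for \<tau>
    by (simp add: B_def mem_box_cart)
  have "0 \<in> B"
    using R by (simp add: B)
  have "continuous_on B h"
    unfolding h_def
    by (intro continuous_intros continuous_on_subset[OF continuous_on_expected_max]
        continuous_on_subset[OF continuous_on_min_inner[OF K(1) \<open>K \<noteq> {}\<close> K(2)]]) auto
  then obtain \<tau> where \<tau>: "\<And>\<sigma>. \<sigma> \<in> B \<Longrightarrow> h \<tau> \<le> h \<sigma>"
    using continuous_attains_inf[of B h] \<open>0 \<in> B\<close> by (auto simp: B_def)
  have "h \<tau> \<le> h \<sigma>" for \<sigma>
  proof -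
    \<comment> \<open>With zero noise the maximizers are the largest coordinates of \<sigma>;
      subtracting that coordinate normalizes the maximum to 0.\<close>
    obtain v where v: "v \<in> maximizers 0 \<sigma>"
      using maximizers_nonempty by blast
    define \<sigma>' where "\<sigma>' = \<sigma> + (\<chi> u. - \<sigma> $ v)"
    have \<sigma>': "\<sigma>' $ u \<le> 0" "\<sigma>' $ v = 0" for u
      using v by (auto simp: \<sigma>'_def maximizers_iff)
    have "h \<tau> \<le> h \<sigma>'"
    proof (cases "\<sigma>' \<in> B")
      case False
      then obtain u where u: "\<sigma>' $ u < - R"
        using \<sigma>' by (auto simp: B not_le)
      have "min_inner K \<sigma>' \<le> \<sigma>' \<bullet> p"
        using K(1) p(1) by (rule min_inner_le)
      also have "\<dots> \<le> \<sigma>' $ u * p $ u"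
      proof -
        have "- (\<sigma>' $ u * p $ u) \<le> (\<Sum>w\<in>UNIV. - (\<sigma>' $ w * p $ w))"
          by (rule member_le_sum) (use \<sigma>'(1) p(2) in \<open>auto intro: mult_nonpos_nonneg less_imp_le\<close>)
        then show ?thesis
          by (simp add: inner_vec_def sum_negf)
      qed
      also have "\<dots> \<le> \<sigma>' $ u * m"
        using \<sigma>'(1) m by (intro mult_left_mono_neg)
      also have "\<dots> \<le> - R * m"
        using u m(1) by (intro mult_right_mono) auto
      finally have "min_inner K \<sigma>' \<le> - 2 * c"
        using R(2) by simp
      moreover have "- c \<le> expected_max \<sigma>'"
        using expected_max_ge[of v \<sigma>'] \<sigma>'(2) c(2)[of v] by simp
      ultimately have "h 0 \<le> h \<sigma>'"
        using h0 by (simp add: h_def)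
      then show ?thesis
        using \<tau>[OF \<open>0 \<in> B\<close>] by linarith
    qed (rule \<tau>)
    then show ?thesis
      by (simp only: \<sigma>'_def h_shift)
  qed
  then show ?thesis
    by (auto simp: h_def)
qed

text \<open>Under a small push along d, the new maximizers are those old ones with the largest
  d-coordinate. Since f already prefers these, the selected d-value is eventually constant for each
  g, and dominated convergence applies.\<close>

lemma mean_select_perturbation_tendsto:
  assumes f: "selector f" and t: "t \<longlonglongrightarrow> 0" "\<And>n. 0 < t n"
    and greatest: "\<And>A a. a \<in> A \<Longrightarrow> d $ a \<le> d $ f A"
  shows "(\<lambda>n. d \<bullet> mean D (select f (\<tau> + t n *\<^sub>R d))) \<longlonglongrightarrow> d \<bullet> mean D (select f \<tau>)"
proof -
  have policy: "policy D (select f \<sigma>)" for \<sigma>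
    using greedy_select[OF f] by (simp add: greedy_policy_def)
  have "(\<lambda>n. \<integral>g. d $ f (maximizers g (\<tau> + t n *\<^sub>R d)) \<partial>D)
      \<longlonglongrightarrow> (\<integral>g. d $ f (maximizers g \<tau>) \<partial>D)"
  proof (rule integral_dominated_convergence[where w = "\<lambda>_. norm d"])
    show "(\<lambda>g. d $ f (maximizers g \<sigma>)) \<in> borel_measurable D" for \<sigma>
      by (rule measurable_compose[OF maximizers_measurable]) simp
    then show "(\<lambda>g. d $ f (maximizers g (\<tau> + t n *\<^sub>R d))) \<in> borel_measurable D" for n .
    show "AE g in D. (\<lambda>n. d $ f (maximizers g (\<tau> + t n *\<^sub>R d))) \<longlonglongrightarrow> d $ f (maximizers g \<tau>)"
    proof (rule AE_I2)
      fix g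
      define u where "u = f (maximizers g \<tau>)"
      have u: "u \<in> maximizers g \<tau>"
        unfolding u_def by (rule selector_maximizers[OF f])
      \<comment> \<open>Each strict gap to a non-maximizer survives a small perturbation, and there
        are only finitely many gaps.\<close>
      have "\<forall>\<^sub>F n in sequentially. \<forall>w. w \<notin> maximizers g \<tau> \<longrightarrow>
          g $ w + (\<tau> + t n *\<^sub>R d) $ w < g $ u + (\<tau> + t n *\<^sub>R d) $ u"
      proof (rule eventually_all_finite, rule eventually_mono)
        fix w
        have "w \<notin> maximizers g \<tau> \<Longrightarrow> g $ w + \<tau> $ w < g $ u + \<tau> $ u"
          using u unfolding maximizers_iff by (meson not_le order_le_less_trans)
        moreover have "(\<lambda>n. (g $ u + (\<tau> + t n *\<^sub>R d) $ u) - (g $ w + (\<tau> + t n *\<^sub>R d) $ w))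
            \<longlonglongrightarrow> (g $ u + (\<tau> $ u + 0 * d $ u)) - (g $ w + (\<tau> $ w + 0 * d $ w))"
          unfolding vector_add_component vector_scaleR_component real_scaleR_def
          by (intro tendsto_intros t(1))
        ultimately show "\<forall>\<^sub>F n in sequentially. w \<notin> maximizers g \<tau> \<longrightarrow>
            0 < (g $ u + (\<tau> + t n *\<^sub>R d) $ u) - (g $ w + (\<tau> + t n *\<^sub>R d) $ w)"
          by (cases "w \<in> maximizers g \<tau>") (auto dest: order_tendstoD(1)[where a = 0])
      qed simp
      then have "\<forall>\<^sub>F n in sequentially. d $ f (maximizers g (\<tau> + t n *\<^sub>R d)) = d $ u"
      proof (rule eventually_mono)
        fix n
        assume *: "\<forall>w. w \<notin> maximizers g \<tau> \<longrightarrow>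
          g $ w + (\<tau> + t n *\<^sub>R d) $ w < g $ u + (\<tau> + t n *\<^sub>R d) $ u"
        define v where "v = f (maximizers g (\<tau> + t n *\<^sub>R d))"
        have v: "v \<in> maximizers g (\<tau> + t n *\<^sub>R d)"
          unfolding v_def by (rule selector_maximizers[OF f])
        then have le: "g $ u + (\<tau> + t n *\<^sub>R d) $ u \<le> g $ v + (\<tau> + t n *\<^sub>R d) $ v"
          by (simp only: maximizers_iff)
        then have vM: "v \<in> maximizers g \<tau>"
          using * by (meson not_le)
        then have "g $ v + \<tau> $ v = g $ u + \<tau> $ u"
          using u max_value_maximizers by metis
        \<comment> \<open>u and v tie at \<tau>, so the perturbed comparison reduces to their
          d-coordinates.\<close>
        then have "t n * d $ u \<le> t n * d $ v"
          using le by simp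
        then have "d $ u \<le> d $ v"
          using t(2)[of n] by simp
        moreover have "d $ v \<le> d $ u"
          unfolding u_def using vM by (rule greatest)
        ultimately show "d $ f (maximizers g (\<tau> + t n *\<^sub>R d)) = d $ u"
          by (simp add: v_def)
      qed
      then show "(\<lambda>n. d $ f (maximizers g (\<tau> + t n *\<^sub>R d))) \<longlonglongrightarrow> d $ f (maximizers g \<tau>)"
        unfolding u_def by (rule tendsto_eventually)
    qed
  qed (auto simp: component_le_norm_cart)
  then show ?thesis
    by (simp add: integral_inner_policy[OF policy, symmetric] inner_select)
qed

text \<open>This replaces an intersection of subdifferentials: the convex hull of selector means
  must meet the face of K on which \<tau> is minimal.\<close>

lemma dual_minimizer_greedy:
  assumes K: "compact K" "convex K" "K \<noteq> {}" "K \<subseteq> prob_vectors"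
    and \<tau>: "\<And>\<sigma>. expected_max \<tau> - min_inner K \<tau> \<le> expected_max \<sigma> - min_inner K \<sigma>"
  obtains q where "greedy_policy D \<tau> q" "mean D q \<in> K" "\<tau> \<bullet> mean D q = min_inner K \<tau>"
proof -
  \<comment> \<open>F is finite because there are finitely many selectors, so its convex hull is
    compact and strict separation is available.\<close>
  define F where "F = (\<lambda>f. mean D (select f \<tau>)) ` {f. selector f}"
  define A where "A = {r \<in> K. \<tau> \<bullet> r = min_inner K \<tau>}"
  have "convex hull F \<inter> A \<noteq> {}"
  proof
    assume disj: "convex hull F \<inter> A = {}"
    have A: "A = K \<inter> {r. \<tau> \<bullet> r = min_inner K \<tau>}"
      by (auto simp: A_def)
    have "convex A" "compact A"
      unfolding A using K(1,2)
      by (auto intro!: convex_Int convex_hyperplane compact_Int_closed closed_hyperplane)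
    moreover have "A \<noteq> {}"
      using min_inner_attained[OF K(1,3), of \<tau>] unfolding A_def by (metis (mono_tags, lifting) empty_iff mem_Collect_eq)
    moreover have "compact (convex hull F)"
      by (intro finite_imp_compact_convex_hull) (simp add: F_def)
    moreover have "convex hull F \<noteq> {}"
      using selector_SOME by (auto simp: F_def)
    ultimately obtain d b where d: "\<And>x. x \<in> convex hull F \<Longrightarrow> d \<bullet> x < b" "\<And>x. x \<in> A \<Longrightarrow> b < d \<bullet> x"
      using separating_hyperplane_compact_closed[of "convex hull F" A] disj
      by (metis convex_convex_hull compact_imp_closed)
    define t where "t n = 1 / real (Suc n)" for n
    have t: "t \<longlonglongrightarrow> 0" "\<And>n. 0 < t n"
      using LIMSEQ_Suc[OF lim_1_over_n] by (auto simp: t_def[abs_def])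
    \<comment> \<open>Produces a selector that breaks ties in favor of the largest d-coordinate. The
      \<open>A\<close> bound here is a set of indices, not the face of K.\<close>
    have "\<exists>a. A \<noteq> {} \<longrightarrow> a \<in> A \<and> (\<forall>b\<in>A. d $ b \<le> d $ a)" for A
    proof (cases "A = {}")
      case False
      then have "Max (($) d ` A) \<in> ($) d ` A"
        by (intro Max_in) auto
      then obtain a where "a \<in> A" "Max (($) d ` A) = d $ a"
        by (rule imageE)
      then show ?thesis
        using Max_ge[of "($) d ` A"] by (metis finite finite_imageI imageI)
    qed simp
    then obtain f where f_max: "\<And>A. A \<noteq> {} \<Longrightarrow> f A \<in> A \<and> (\<forall>b\<in>A. d $ b \<le> d $ f A)"
      by metis
    then have f: "selector f" and greatest: "\<And>A a. a \<in> A \<Longrightarrow> d $ a \<le> d $ f A"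
      unfolding selector_def by blast+
    have "\<forall>n. \<exists>r. r \<in> K \<and> min_inner K (\<tau> + t n *\<^sub>R d) = (\<tau> + t n *\<^sub>R d) \<bullet> r"
      using min_inner_attained[OF K(1,3)] by blast
    then obtain r where r: "\<And>n. r n \<in> K" "\<And>n. min_inner K (\<tau> + t n *\<^sub>R d) = (\<tau> + t n *\<^sub>R d) \<bullet> r n"
      by metis
    \<comment> \<open>Minimality of \<tau> is tested at the perturbed point. There q and
      \<open>r n\<close> attain both dual terms, while at \<tau> they only give bounds; what remains
      is a multiple of t n.\<close>
    have step: "d \<bullet> r n \<le> d \<bullet> mean D (select f (\<tau> + t n *\<^sub>R d))" for n
    proof -
      define q where "q = select f (\<tau> + t n *\<^sub>R d)"
      have q: "greedy_policy D (\<tau> + t n *\<^sub>R d) q"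
        unfolding q_def by (rule greedy_select[OF f])
      have "expected_max \<tau> - min_inner K \<tau> \<le>
          objective D q + (\<tau> + t n *\<^sub>R d) \<bullet> mean D q - (\<tau> + t n *\<^sub>R d) \<bullet> r n"
        using \<tau>[of "\<tau> + t n *\<^sub>R d"] objective_greedy[OF q] r(2)[of n] by simp
      moreover have "objective D q + \<tau> \<bullet> mean D q \<le> expected_max \<tau>"
        using q by (intro objective_le_expected_max) (simp add: greedy_policy_def)
      moreover have "min_inner K \<tau> \<le> \<tau> \<bullet> r n"
        using K(1) r(1) by (rule min_inner_le)
      ultimately have "t n * (d \<bullet> r n) \<le> t n * (d \<bullet> mean D q)"
        by (simp add: inner_add_left)
      then show ?thesis
        using t(2)[of n] by (simp add: q_def)
    qed
    \<comment> \<open>A limit of the perturbed minimizers lies in the face by continuity. Passing to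
      the limit in \<open>step\<close> puts it on the wrong side of the hyperplane.\<close>
    obtain l \<sigma> where l: "l \<in> K" "strict_mono \<sigma>" "(r \<circ> \<sigma>) \<longlonglongrightarrow> l"
      using K(1) r(1) unfolding compact_def by metis
    have t\<sigma>: "(\<lambda>n. t (\<sigma> n)) \<longlonglongrightarrow> 0"
      using LIMSEQ_subseq_LIMSEQ[OF t(1) l(2)] by (simp add: o_def)
    have r\<sigma>: "(\<lambda>n. r (\<sigma> n)) \<longlonglongrightarrow> l"
      using l(3) by (simp add: o_def)
    have path: "(\<lambda>n. \<tau> + t (\<sigma> n) *\<^sub>R d) \<longlonglongrightarrow> \<tau> + 0 *\<^sub>R d"
      by (intro tendsto_intros t\<sigma>)
    have "(\<lambda>n. (\<tau> + t (\<sigma> n) *\<^sub>R d) \<bullet> r (\<sigma> n)) \<longlonglongrightarrow> (\<tau> + 0 *\<^sub>R d) \<bullet> l"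
      by (intro tendsto_inner path r\<sigma>)
    moreover have "(\<lambda>n. min_inner K (\<tau> + t (\<sigma> n) *\<^sub>R d)) \<longlonglongrightarrow> min_inner K (\<tau> + 0 *\<^sub>R d)"
      by (rule continuous_on_tendsto_compose[OF continuous_on_min_inner[OF K(1,3,4)] path]) simp_all
    ultimately have "(\<tau> + 0 *\<^sub>R d) \<bullet> l = min_inner K (\<tau> + 0 *\<^sub>R d)"
      unfolding r(2) by (rule LIMSEQ_unique)
    then have "l \<in> A"
      using l(1) by (simp add: A_def)
    have "(\<lambda>n. d \<bullet> r (\<sigma> n)) \<longlonglongrightarrow> d \<bullet> l"
      by (intro tendsto_intros r\<sigma>)
    moreover have "(\<lambda>n. d \<bullet> mean D (select f (\<tau> + t (\<sigma> n) *\<^sub>R d))) \<longlonglongrightarrow> d \<bullet> mean D (select f \<tau>)"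
      using f t\<sigma> t(2) greatest by (rule mean_select_perturbation_tendsto)
    ultimately have "d \<bullet> l \<le> d \<bullet> mean D (select f \<tau>)"
      by (rule LIMSEQ_le) (auto intro: step)
    moreover have "d \<bullet> mean D (select f \<tau>) < b"
      using f by (intro d(1) hull_inc) (auto simp: F_def)
    ultimately show False
      using d(2)[OF \<open>l \<in> A\<close>] by linarith
  qed
  moreover have "convex hull F \<subseteq> {mean D q |q. greedy_policy D \<tau> q}"
    by (intro hull_minimal convex_greedy_means) (auto simp: F_def intro: greedy_select)
  ultimately show ?thesis
    using that by (auto simp: A_def)
qed

text \<open>If \<tau> = 0 is feasible, its threshold policy is an unconstrained maximizer. Otherwise
  strong duality supplies an optimum, and slack would leave room to move toward an unconstrained
  maximizer.\<close>

lemma optimal_threshold_policy: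
  assumes p: "p \<in> prob_vectors" "\<forall>u. 0 < p $ u" and "0 \<le> \<epsilon>"
  shows "\<exists>\<tau> T. tie_breaking D \<tau> T \<and> optimal D p \<epsilon> (threshold_policy \<tau> T) \<and>
     (if \<exists>T0. tie_breaking D 0 T0 \<and> feasible D p \<epsilon> (threshold_policy 0 T0)
      then \<tau> = 0
      else KL (mean D (threshold_policy \<tau> T)) p = \<epsilon>)"
proof (cases "\<exists>T0. tie_breaking D 0 T0 \<and> feasible D p \<epsilon> (threshold_policy 0 T0)")
  case True
  then obtain T0 where T0: "tie_breaking D 0 T0" "feasible D p \<epsilon> (threshold_policy 0 T0)"
    by blast
  then have "optimal D p \<epsilon> (threshold_policy 0 T0)"
    by (intro optimalI[of 0] greedy_threshold_policy) (auto simp: feasible_def)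
  with T0 True show ?thesis
    by auto
next
  case False
  define K where "K = {r \<in> prob_vectors. KL r p \<le> \<epsilon>}"
  have K: "compact K" "convex K" "K \<subseteq> prob_vectors" "p \<in> K"
    using p \<open>0 \<le> \<epsilon>\<close> by (auto simp: K_def compact_KL_ball convex_KL_ball)
  then obtain \<tau> where "\<And>\<sigma>. expected_max \<tau> - min_inner K \<tau> \<le> expected_max \<sigma> - min_inner K \<sigma>"
    using dual_minimizer_exists[of K p] p by blast
  then obtain q' where q': "greedy_policy D \<tau> q'" "mean D q' \<in> K" "\<tau> \<bullet> mean D q' = min_inner K \<tau>"
    using dual_minimizer_greedy[of K \<tau>] K by blast
  define T where "T g u = q' g $ u" for g u
  define q where "q = threshold_policy \<tau> T"
  have T: "tie_breaking D \<tau> T"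
    unfolding T_def using q'(1) by (rule greedy_policy_tie_breaking)
  then have q: "greedy_policy D \<tau> q"
    unfolding q_def by (rule greedy_threshold_policy)
  then have policy: "policy D q"
    by (simp add: greedy_policy_def)
  \<comment> \<open>The threshold policy is known to agree with q' only on \<open>space D\<close>,
    which suffices for the means.\<close>
  have "mean D q = mean D q'"
    using policy q'(1) greedy_policy_tie_breaking(2)[OF q'(1)]
    by (intro mean_cong_AE AE_I2) (simp_all add: q_def T_def[abs_def] greedy_policy_def)
  with q' have mean: "KL (mean D q) p \<le> \<epsilon>" "\<tau> \<bullet> mean D q = min_inner K \<tau>"
    by (auto simp: K_def)
  have opt: "optimal D p \<epsilon> q"
    using q mean(1)
  proof (rule optimalI)
    show "\<tau> \<bullet> mean D q \<le> \<tau> \<bullet> r" if "r \<in> prob_vectors" "KL r p \<le> \<epsilon>" for r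
      unfolding mean(2) using K(1) that by (intro min_inner_le) (auto simp: K_def)
  qed
  have "KL (mean D q) p = \<epsilon>"
  proof (rule ccontr)
    assume "KL (mean D q) p \<noteq> \<epsilon>"
    with mean(1) have less: "KL (mean D q) p < \<epsilon>"
      by simp
    define s where "s = select (\<lambda>A. SOME a. a \<in> A) (0 :: real^'a)"
    have s: "greedy_policy D 0 s"
      unfolding s_def by (intro greedy_select selector_SOME)
    then have s': "policy D s"
      by (simp add: greedy_policy_def)
    \<comment> \<open>Otherwise q would be almost surely greedy at 0; repaired on a null set, it
      would be a feasible threshold policy with zero shift, contrary to the case assumption.\<close>
    have "objective D q \<noteq> objective D s"
    proof
      assume "objective D q = objective D s"
      then have "objective D q + 0 \<bullet> mean D q = expected_max 0"
        using objective_greedy[OF s] by simp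
      from objective_eq_expected_max_imp_AE[OF policy this] obtain q0
        where q0: "greedy_policy D 0 q0" "AE g in D. q0 g = q g"
        using greedy_modification[OF policy] by blast
      define T0 where "T0 g u = q0 g $ u" for g u
      have T0: "tie_breaking D 0 T0"
        unfolding T0_def using q0(1) by (rule greedy_policy_tie_breaking)
      have q0': "greedy_policy D 0 (threshold_policy 0 T0)"
        using T0 by (rule greedy_threshold_policy)
      have "AE g in D. threshold_policy 0 T0 g = q g"
        using q0(2) greedy_policy_tie_breaking(2)[OF q0(1)] by (auto simp: T0_def[abs_def])
      then have "mean D (threshold_policy 0 T0) = mean D q"
        using q0' policy by (intro mean_cong_AE) (auto simp: greedy_policy_def)
      then have "feasible D p \<epsilon> (threshold_policy 0 T0)"
        using q0' mean(1) by (simp add: feasible_def greedy_policy_def)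
      with T0 False show False
        by blast
    qed
    moreover have "objective D q \<le> objective D s"
      using objective_le_expected_max[OF policy, of 0] objective_greedy[OF s] by simp
    ultimately have better: "objective D q < objective D s"
      by simp
    define \<delta> where "\<delta> = \<epsilon> - KL (mean D q) p"
    define \<eta> where "\<eta> = \<bar>KL (mean D s) p - KL (mean D q) p\<bar>"
    \<comment> \<open>Mixing weight for which the KL increase, at most t \<eta> by convexity, fits
      into the slack \<delta>. The positive slack gives 0 < t \<le> 1 even if \<eta> = 0.\<close>
    define t where "t = \<delta> / (\<delta> + \<eta>)"
    have t: "0 < t" "t \<le> 1" "t * \<eta> \<le> \<delta>"
    proof -
      have "0 < \<delta>" "0 \<le> \<eta>"
        using less by (auto simp: \<delta>_def \<eta>_def)
      then show "0 < t" "t \<le> 1"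
        by (auto simp: t_def)
      have "t * \<eta> = \<delta> * (\<eta> / (\<delta> + \<eta>))"
        by (simp add: t_def)
      also have "\<dots> \<le> \<delta>"
        using \<open>0 < \<delta>\<close> \<open>0 \<le> \<eta>\<close> by (intro mult_left_le) auto
      finally show "t * \<eta> \<le> \<delta>" .
    qed
    define mix where "mix g = (1 - t) *\<^sub>R q g + t *\<^sub>R s g" for g
    have mix: "policy D mix"
      unfolding mix_def[abs_def] using policy s' t by (intro policy_convex_combination) auto
    have "KL (mean D mix) p \<le> (1 - t) * KL (mean D q) p + t * KL (mean D s) p"
      unfolding mix_def[abs_def] mean_convex_combination[OF policy s']
      using p(2) t policy s' by (intro KL_convex mean_in_prob_vectors) auto
    also have "\<dots> = KL (mean D q) p + t * (KL (mean D s) p - KL (mean D q) p)"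
      by algebra
    also have "\<dots> \<le> KL (mean D q) p + t * \<eta>"
      using t by (intro add_left_mono mult_left_mono) (auto simp: \<eta>_def)
    also have "\<dots> \<le> \<epsilon>"
      using t(3) by (simp add: \<delta>_def)
    finally have "feasible D p \<epsilon> mix"
      using mix by (simp add: feasible_def)
    moreover have "objective D q < objective D mix"
    proof -
      have "t * objective D q < t * objective D s"
        using better t by simp
      then show ?thesis
        unfolding mix_def[abs_def] objective_convex_combination[OF policy s']
        by (simp add: algebra_simps)
    qed
    ultimately show False
      using opt by (auto simp: optimal_def is_arg_max_def)
  qed
  with T opt False show ?thesis
    unfolding q_def by auto
qed

end

section \<open>Gumbel coordinates\<close>

text \<open>The law of the maximizing index of standard Gumbel noise shifted by \<tau>. For \<tau> =
  \<alpha> log p it is the normalized power p^\<alpha>.\<close>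

definition softmax :: "real^'a::finite \<Rightarrow> real^'a" where
  "softmax \<tau> = (\<chi> u. exp (\<tau> $ u) / (\<Sum>v\<in>UNIV. exp (\<tau> $ v)))"

lemma softmax_denominator_pos: "0 < (\<Sum>v\<in>UNIV. exp ((\<tau> :: real^'a::finite) $ v))"
  by (rule sum_pos) auto

lemma softmax_pos: "0 < softmax \<tau> $ u"
  using divide_pos_pos[OF exp_gt_zero softmax_denominator_pos] by (simp add: softmax_def)

lemma softmax_in_prob_vectors: "softmax \<tau> \<in> prob_vectors"
  using softmax_denominator_pos[of \<tau>] softmax_pos[of \<tau>]
  by (auto simp: prob_vectors_def softmax_def less_imp_le simp flip: sum_divide_distrib)

lemma continuous_on_softmax [continuous_intros]:
  assumes "continuous_on S f"
  shows "continuous_on S (\<lambda>x. softmax (f x))"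
  unfolding softmax_def
  using softmax_denominator_pos by (intro continuous_intros assms ballI less_imp_neq[symmetric]) auto

lemma softmax_ln:
  assumes "p \<in> prob_vectors" "\<forall>u. 0 < p $ u"
  shows "softmax (\<chi> u. ln (p $ u)) = p"
  using assms by (simp add: softmax_def prob_vectors_def vec_eq_iff)

text \<open>The log ratio of two softmax vectors is \<tau> - \<sigma> up to a constant from the
  normalizers, so changing the reference alters KL by an affine function of r.\<close>

lemma KL_softmax:
  fixes \<sigma> \<tau> :: "real^'a::finite"
  shows "\<exists>c. \<forall>r\<in>prob_vectors. KL r (softmax \<sigma>) = KL r (softmax \<tau>) + (\<tau> - \<sigma>) \<bullet> r - c"
proof (intro exI ballI)
  define Z where "Z \<tau> = (\<Sum>v\<in>UNIV. exp (\<tau> $ v))" for \<tau> :: "real^'a"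
  have Z: "0 < Z \<tau>" for \<tau>
    unfolding Z_def by (rule softmax_denominator_pos)
  fix r :: "real^'a" assume r: "r \<in> prob_vectors"
  have "ln (softmax \<tau> $ u / softmax \<sigma> $ u) = (\<tau> - \<sigma>) $ u - (ln (Z \<tau>) - ln (Z \<sigma>))" for u
    using Z[of \<tau>] Z[of \<sigma>] by (simp add: softmax_def Z_def[symmetric] ln_div ln_mult)
  then have "KL r (softmax \<sigma>) = KL r (softmax \<tau>) +
      (\<Sum>u\<in>UNIV. r $ u * ((\<tau> - \<sigma>) $ u - (ln (Z \<tau>) - ln (Z \<sigma>))))"
    using KL_change_reference[OF r, of "softmax \<tau>" "softmax \<sigma>"] by (simp add: softmax_pos)
  also have "(\<Sum>u\<in>UNIV. r $ u * ((\<tau> - \<sigma>) $ u - (ln (Z \<tau>) - ln (Z \<sigma>)))) =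
      (\<tau> - \<sigma>) \<bullet> r - (\<Sum>u\<in>UNIV. r $ u) * (ln (Z \<tau>) - ln (Z \<sigma>))"
    unfolding right_diff_distrib sum_subtractf sum_distrib_right by (simp add: inner_vec_def mult.commute)
  finally show "KL r (softmax \<sigma>) = KL r (softmax \<tau>) + (\<tau> - \<sigma>) \<bullet> r - (ln (Z \<tau>) - ln (Z \<sigma>))"
    using r by (simp add: prob_vectors_def)
qed

text \<open>On the exponential path from the uniform vector s to \<open>softmax \<tau>\<close>, the
  start is farthest from the end: the excess is KL s r + (1 - \<beta>)(\<tau> r - \<tau> s), with
  both terms nonnegative.\<close>

lemma KL_softmax_scale_le:
  assumes "0 \<le> \<beta>" "\<beta> \<le> 1"
  shows "KL (softmax (\<beta> *\<^sub>R \<tau>)) (softmax \<tau>) \<le> KL (softmax 0) (softmax \<tau>)"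
proof (cases "\<beta> = 0")
  case False
  define r s where "r = softmax (\<beta> *\<^sub>R \<tau>)" and "s = softmax (0 :: real^'a)"
  have rs: "r \<in> prob_vectors" "s \<in> prob_vectors" "\<forall>u. 0 < r $ u" "\<forall>u. 0 < s $ u"
    by (auto simp: r_def s_def softmax_in_prob_vectors softmax_pos)
  obtain c where c: "\<And>x. x \<in> prob_vectors \<Longrightarrow> KL x (softmax \<tau>) = KL x r + (\<beta> *\<^sub>R \<tau> - \<tau>) \<bullet> x - c"
    unfolding r_def using KL_softmax[of \<tau> "\<beta> *\<^sub>R \<tau>"] by blast
  obtain c' where c': "\<And>x. x \<in> prob_vectors \<Longrightarrow> KL x s = KL x r + (\<beta> *\<^sub>R \<tau> - 0) \<bullet> x - c'"
    unfolding r_def s_def using KL_softmax[of 0 "\<beta> *\<^sub>R \<tau>"] by blast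
  \<comment> \<open>Evaluating the affine identity at r and at s eliminates the constant and leaves
    the symmetrized divergence.\<close>
  have "\<beta> * (\<tau> \<bullet> r - \<tau> \<bullet> s) = KL r s + KL s r"
    using c'[OF rs(1)] c'[OF rs(2)] by (simp add: algebra_simps)
  moreover have "0 \<le> KL r s" "0 \<le> KL s r"
    using rs by (auto intro: KL_nonneg)
  ultimately have "0 \<le> \<beta> * (\<tau> \<bullet> r - \<tau> \<bullet> s)"
    by linarith
  then have "\<tau> \<bullet> s \<le> \<tau> \<bullet> r"
    using False assms by (simp add: zero_le_mult_iff)
  then have "(1 - \<beta>) * (\<tau> \<bullet> s) \<le> (1 - \<beta>) * (\<tau> \<bullet> r)"
    using assms by (intro mult_left_mono) auto
  then have "KL r (softmax \<tau>) \<le> KL s (softmax \<tau>)"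
    using c[OF rs(1)] c[OF rs(2)] \<open>0 \<le> KL s r\<close> by (simp add: inner_diff_left algebra_simps)
  then show ?thesis
    by (simp add: r_def s_def)
qed simp

text \<open>Supplies the mean condition of \<open>optimalI\<close> when the KL ball has the tilted
  vector on its boundary.\<close>

lemma softmax_scale_minimizes:
  assumes \<alpha>: "0 \<le> \<alpha>" "\<alpha> \<le> 1"
    and r: "r \<in> prob_vectors" "KL r (softmax \<tau>) \<le> KL (softmax (\<alpha> *\<^sub>R \<tau>)) (softmax \<tau>)"
  shows "(\<alpha> *\<^sub>R \<tau>) \<bullet> softmax (\<alpha> *\<^sub>R \<tau>) \<le> (\<alpha> *\<^sub>R \<tau>) \<bullet> r"
proof -
  define s where "s = softmax (\<alpha> *\<^sub>R \<tau>)"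
  have s: "s \<in> prob_vectors" "\<forall>u. 0 < s $ u"
    by (auto simp: s_def softmax_in_prob_vectors softmax_pos)
  obtain c where c: "\<And>x. x \<in> prob_vectors \<Longrightarrow> KL x (softmax \<tau>) = KL x s + (\<alpha> *\<^sub>R \<tau> - \<tau>) \<bullet> x - c"
    unfolding s_def using KL_softmax[of \<tau> "\<alpha> *\<^sub>R \<tau>"] by blast
  \<comment> \<open>The Pythagorean form of the constraint. For \<alpha> < 1, Gibbs' inequality
    gives the sign of the bracket; for \<alpha> = 1 it forces r = s.\<close>
  have le: "KL r s \<le> (1 - \<alpha>) * (\<tau> \<bullet> r - \<tau> \<bullet> s)"
    using r(2) c[OF r(1)] c[OF s(1)] by (simp add: s_def[symmetric] inner_diff_left algebra_simps)
  have KL: "0 \<le> KL r s"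
    using r s by (intro KL_nonneg)
  show ?thesis
  proof (cases "\<alpha> = 1")
    case True
    then have "KL r s = 0"
      using le KL by simp
    then have "r = s"
      by (rule KL_eq_0_imp_eq[OF r(1) s])
    then show ?thesis
      by (simp add: s_def)
  next
    case False
    have "0 \<le> (1 - \<alpha>) * (\<tau> \<bullet> r - \<tau> \<bullet> s)"
      using le KL by linarith
    then have "\<tau> \<bullet> s \<le> \<tau> \<bullet> r"
      using False \<alpha> by (simp add: zero_le_mult_iff)
    then show ?thesis
      using \<alpha> by (simp add: s_def[symmetric] mult_left_mono)
  qed
qed

section \<open>Optimality when the maximizer follows the softmax law\<close>

context integrable_law
begin

text \<open>The number of maximizers is at least 1, and its expectation is the total softmax mass
  1.\<close>

lemma AE_unique_maximizer:
  assumes softmax: "\<And>u. measure D {g\<in>space D. u \<in> maximizers g \<tau>} = softmax \<tau> $ u"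
  shows "AE g in D. card (maximizers g \<tau>) = 1"
proof -
  let ?I = "\<lambda>u. indicat_real {g\<in>space D. u \<in> maximizers g \<tau>}"
  have [measurable]: "{g\<in>space D. u \<in> maximizers g \<tau>} \<in> sets D" for u
    by measurable
  have int: "integrable D (?I u)" for u
    by (intro integrable_const_bound[where B = 1]) (auto simp: indicator_def)
  have card: "(\<Sum>u\<in>UNIV. ?I u g) = real (card (maximizers g \<tau>))" if "g \<in> space D" for g
    using that by (simp add: indicator_def sum.If_cases)
  have "AE g in D. (\<Sum>u\<in>UNIV. ?I u g) - 1 = 0"
  proof (rule integral_nonneg_eq_0_iff_AE[THEN iffD1])
    show "integrable D (\<lambda>g. (\<Sum>u\<in>UNIV. ?I u g) - 1)"
      using int by simp
    show "AE g in D. 0 \<le> (\<Sum>u\<in>UNIV. ?I u g) - 1"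
    proof (rule AE_I2)
      fix g assume "g \<in> space D"
      have "0 < card (maximizers g \<tau>)"
        using maximizers_nonempty by (simp add: card_gt_0_iff)
      then show "0 \<le> (\<Sum>u\<in>UNIV. ?I u g) - 1"
        using card[OF \<open>g \<in> space D\<close>] by simp
    qed
    have "(\<integral>g. ?I u g \<partial>D) = softmax \<tau> $ u" for u
      using softmax[of u] by simp
    then show "(\<integral>g. (\<Sum>u\<in>UNIV. ?I u g) - 1 \<partial>D) = 0"
      using int softmax_in_prob_vectors[of \<tau>] by (simp add: prob_space prob_vectors_def)
  qed
  then show ?thesis
    by (rule AE_mp) (auto simp: card intro!: AE_I2)
qed

lemma optimal_gumbel_rule:
  assumes p: "p \<in> prob_vectors" "\<forall>u. 0 < p $ u" and "0 \<le> \<epsilon>"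
    and softmax: "\<And>\<tau> u. measure D {g\<in>space D. u \<in> maximizers g \<tau>} = softmax \<tau> $ u"
  shows "\<exists>\<alpha>\<in>{0..1}. \<exists>q. optimal D p \<epsilon> q \<and> (AE g in D. q g = gumbel_rule \<alpha> p g) \<and>
     (if \<exists>\<beta>\<in>{0..1}. KL (mean D (gumbel_rule \<beta> p)) p = \<epsilon> then KL (mean D q) p = \<epsilon> else \<alpha> = 0)"
proof -
  define l where "l = (\<chi> u. ln (p $ u))"
  have softmax_l: "softmax l = p"
    unfolding l_def using p by (rule softmax_ln)
  have scale: "(\<chi> u. \<alpha> * ln (p $ u)) = \<alpha> *\<^sub>R l" for \<alpha>
    by (simp add: l_def vec_eq_iff)
  have mean_rule: "mean D (gumbel_rule \<alpha> p) = softmax (\<alpha> *\<^sub>R l)" for \<alpha>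
  proof -
    have "(\<integral>g. gumbel_rule \<alpha> p g $ u \<partial>D) =
        (\<integral>g. indicat_real {g\<in>space D. u \<in> maximizers g (\<alpha> *\<^sub>R l)} g \<partial>D)" for u
      by (intro Bochner_Integration.integral_cong) (auto simp: gumbel_rule_def scale indicator_def)
    then show ?thesis
      using softmax by (simp add: mean_def vec_eq_iff)
  qed
  \<comment> \<open>The indicator rule is not a probability vector at ties. The selected version is
    a policy everywhere and differs from it only on a null set.\<close>
  define q where "q \<alpha> = select (\<lambda>A. SOME a. a \<in> A) (\<alpha> *\<^sub>R l)" for \<alpha> :: real
  have greedy: "greedy_policy D (\<alpha> *\<^sub>R l) (q \<alpha>)" for \<alpha>
    unfolding q_def by (intro greedy_select selector_SOME)
  have AE: "AE g in D. q \<alpha> g = gumbel_rule \<alpha> p g" for \<alpha>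
    using AE_unique_maximizer[OF softmax, of "\<alpha> *\<^sub>R l"]
  proof (rule AE_mp, intro AE_I2 impI)
    fix g assume "card (maximizers g (\<alpha> *\<^sub>R l)) = 1"
    then obtain v where "maximizers g (\<alpha> *\<^sub>R l) = {v}"
      by (auto simp: card_1_singleton_iff)
    then show "q \<alpha> g = gumbel_rule \<alpha> p g"
      by (simp add: q_def select_def gumbel_rule_def scale vec_eq_iff axis_def indicator_def)
  qed
  have mean_q: "mean D (q \<alpha>) = softmax (\<alpha> *\<^sub>R l)" for \<alpha>
  proof -
    have "(\<lambda>g. indicat_real (maximizers g (\<alpha> *\<^sub>R l)) u) \<in> borel_measurable D" for u
      by (rule measurable_compose[OF maximizers_measurable]) simp
    then have "mean D (q \<alpha>) = mean D (gumbel_rule \<alpha> p)"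
      unfolding mean_def using AE[of \<alpha>] greedy[of \<alpha>]
      by (auto simp: vec_eq_iff gumbel_rule_def scale greedy_policy_def policy_measurable
          intro!: integral_cong_AE)
    then show ?thesis
      by (simp add: mean_rule)
  qed
  define k where "k \<alpha> = KL (softmax (\<alpha> *\<^sub>R l)) p" for \<alpha> :: real
  have k_le: "k \<beta> \<le> k 0" if "\<beta> \<in> {0..1}" for \<beta>
    using KL_softmax_scale_le[of \<beta> l] that by (simp add: k_def softmax_l)
  show ?thesis
  proof (cases "k 0 \<le> \<epsilon>")
    case True
    have "optimal D p \<epsilon> (q 0)"
      using greedy[of 0] True by (intro optimalI[of 0]) (auto simp: mean_q k_def)
    \<comment> \<open>Since k is largest at 0 and k 0 \<le> \<epsilon>, the value \<epsilon> can be
      reached only if k 0 = \<epsilon>; thus \<alpha> = 0 serves both branches.\<close>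
    moreover have "KL (mean D (q 0)) p = \<epsilon>" if "\<beta> \<in> {0..1}" "k \<beta> = \<epsilon>" for \<beta>
      using k_le[OF that(1)] that(2) True by (simp add: mean_q k_def)
    ultimately show ?thesis
      using AE[of 0] by (intro bexI[of _ 0] exI[of _ "q 0"]) (auto simp: mean_rule k_def)
  next
    case False
    \<comment> \<open>The path ends at p, so k falls from above \<epsilon> at 0 to the value 0 at 1,
      and some \<alpha> in between hits \<epsilon>.\<close>
    have "continuous_on {0..1} k"
      unfolding k_def
      by (intro continuous_on_compose2[OF continuous_on_KL[OF p(2)]] continuous_intros)
        (auto simp: softmax_in_prob_vectors)
    moreover have "k 1 \<le> \<epsilon>"
      using \<open>0 \<le> \<epsilon>\<close> by (simp add: k_def softmax_l)
    ultimately obtain \<alpha> where \<alpha>: "0 \<le> \<alpha>" "\<alpha> \<le> 1" "k \<alpha> = \<epsilon>"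
      using IVT2'[of k 1 \<epsilon> 0] False by auto
    have "optimal D p \<epsilon> (q \<alpha>)"
      using greedy[of \<alpha>]
    proof (rule optimalI)
      show "KL (mean D (q \<alpha>)) p \<le> \<epsilon>"
        using \<alpha> by (simp add: mean_q k_def)
      show "(\<alpha> *\<^sub>R l) \<bullet> mean D (q \<alpha>) \<le> (\<alpha> *\<^sub>R l) \<bullet> r" if "r \<in> prob_vectors" "KL r p \<le> \<epsilon>" for r
        unfolding mean_q using \<alpha> that by (intro softmax_scale_minimizes) (auto simp: k_def softmax_l)
    qed
    then show ?thesis
      using \<alpha> AE[of \<alpha>] by (intro bexI[of _ \<alpha>] exI[of _ "q \<alpha>"]) (auto simp: mean_rule mean_q k_def)
  qed
qed

end

section \<open>Improper integrals from antiderivatives\<close>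

lemma nn_integral_FTC_atMost:
  fixes f F :: "real \<Rightarrow> real"
  assumes f: "f \<in> borel_measurable borel"
    and F: "\<And>x. x \<le> a \<Longrightarrow> DERIV F x :> f x"
    and nonneg: "\<And>x. x \<le> a \<Longrightarrow> 0 \<le> f x"
    and lim: "(F \<longlongrightarrow> T) at_bot"
  shows "(\<integral>\<^sup>+x. ennreal (f x) * indicator {..a} x \<partial>lborel) = F a - T"
proof -
  \<comment> \<open>Reflection x to -x reduces the left half-line to the right one, with
    antiderivative -F(-x).\<close>
  have "(\<integral>\<^sup>+x. ennreal (f x) * indicator {..a} x \<partial>lborel) =
      (\<integral>\<^sup>+x. ennreal (f (- x)) * indicator {- a..} x \<partial>lborel)"
    using f by (subst nn_integral_real_affine[where c = "-1" and t = 0])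
      (auto intro!: nn_integral_cong simp: indicator_def)
  also have "\<dots> = - T - - F (- (- a))"
  proof (rule nn_integral_FTC_atLeast)
    show "(\<lambda>x. f (- x)) \<in> borel_measurable borel"
      using f by measurable
    show "DERIV (\<lambda>x. - F (- x)) x :> f (- x)" if "- a \<le> x" for x
      using F[of "- x"] that by (auto intro!: derivative_eq_intros DERIV_chain2[of F])
    show "((\<lambda>x. - F (- x)) \<longlongrightarrow> - T) at_top"
      using lim by (auto intro!: tendsto_minus simp: filterlim_at_bot_mirror)
  qed (use nonneg in auto)
  finally show ?thesis
    by simp
qed

text \<open>Monotone convergence along the half-lines ending at n.\<close>

lemma nn_integral_FTC_UNIV:
  fixes f F :: "real \<Rightarrow> real"
  assumes f: "f \<in> borel_measurable borel"
    and F: "\<And>x. DERIV F x :> f x"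
    and nonneg: "\<And>x. 0 \<le> f x"
    and lim: "(F \<longlongrightarrow> A) at_bot" "(F \<longlongrightarrow> B) at_top"
  shows "(\<integral>\<^sup>+x. ennreal (f x) \<partial>lborel) = B - A"
proof (rule LIMSEQ_unique)
  have [measurable]: "f \<in> borel_measurable lborel"
    using f by simp
  show "(\<lambda>n. \<integral>\<^sup>+x. ennreal (f x) * indicator {..real n} x \<partial>lborel) \<longlonglongrightarrow> (\<integral>\<^sup>+x. ennreal (f x) \<partial>lborel)"
  proof (rule nn_integral_LIMSEQ)
    show "incseq (\<lambda>n x. ennreal (f x) * indicator {..real n} x)"
      by (auto simp: incseq_def le_fun_def indicator_def)
    show "(\<lambda>n. ennreal (f x) * indicator {..real n} x) \<longlonglongrightarrow> ennreal (f x)" for x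
    proof (rule tendsto_eventually)
      show "\<forall>\<^sub>F n in sequentially. ennreal (f x) * indicator {..real n} x = ennreal (f x)"
        using eventually_ge_at_top[of "nat \<lceil>x\<rceil>"]
        by eventually_elim (simp add: indicator_def ceiling_le_iff nat_le_iff)
    qed
  qed simp
  have "(\<lambda>n. F (real n)) \<longlonglongrightarrow> B"
    using lim(2) filterlim_real_sequentially by (rule filterlim_compose)
  then show "(\<lambda>n. \<integral>\<^sup>+x. ennreal (f x) * indicator {..real n} x \<partial>lborel) \<longlonglongrightarrow> ennreal (B - A)"
    using nn_integral_FTC_atMost[OF f F nonneg lim(1)] by (auto intro!: tendsto_intros)
qed

section \<open>The Gumbel law and the Gumbel-max identity\<close>

locale gumbel = real_distribution L for L +
  assumes cdf_gumbel: "cdf L x = exp (- exp (- x))"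
begin

text \<open>The density is the derivative of the distribution function; the law with this density
  has the same distribution function, which determines it.\<close>

lemma density_gumbel: "L = density lborel (\<lambda>x. ennreal (exp (- x) * exp (- exp (- x))))"
proof (rule cdf_unique)
  let ?f = "\<lambda>x::real. exp (- x) * exp (- exp (- x))"
  let ?F = "\<lambda>x::real. exp (- exp (- x))"
  let ?N = "density lborel (\<lambda>x. ennreal (?f x))"
  have deriv: "DERIV ?F x :> ?f x" for x
    by (auto intro!: derivative_eq_intros)
  have bot: "(?F \<longlongrightarrow> 0) at_bot" and top: "(?F \<longlongrightarrow> 1) at_top"
    by real_asymp+
  have "(\<integral>\<^sup>+x. ennreal (?f x) \<partial>lborel) = 1"
    using nn_integral_FTC_UNIV[OF _ deriv _ bot top] by simp
  then have "emeasure ?N (space ?N) = 1"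
    by (simp add: emeasure_density)
  then interpret N: prob_space ?N
    by (rule prob_spaceI)
  show "real_distribution ?N"
    by unfold_locales simp
  have "emeasure ?N {..x} = ennreal (?F x)" for x
    using nn_integral_FTC_atMost[OF _ deriv _ bot, of x] by (simp add: emeasure_density)
  then have "cdf ?N x = ?F x" for x
    by (simp add: cdf_def measure_def)
  then show "cdf L = cdf ?N"
    by (simp add: cdf_gumbel fun_eq_iff)
qed (rule real_distribution_axioms)

lemma integrable_gumbel: "integrable L (\<lambda>x. x)"
proof -
  have bound: "exp (- x) * exp (- exp (- x)) \<le> exp (- \<bar>x\<bar>)" for x :: real
  proof (cases "0 \<le> x")
    case False
    \<comment> \<open>For y = -x > 0 the bound amounts to 2y \<le> exp y, which follows from 1 + y +
      y^2/2 and the square (y - 1)^2.\<close>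
    have "0 \<le> (x + 1)\<^sup>2 + 1"
      by simp
    then have "2 * (- x) \<le> 1 + (- x) + (- x)\<^sup>2 / 2"
      by (simp add: power2_eq_square algebra_simps)
    also have "\<dots> \<le> exp (- x)"
      using False by (intro exp_lower_Taylor_quadratic) simp
    finally show ?thesis
      using False by (simp add: exp_add[symmetric])
  qed simp
  \<comment> \<open>The Gamma integral of value 1! = 1; both half-lines contribute this amount to
    the dominating integral.\<close>
  have half: "(\<integral>\<^sup>+x. ennreal (x * exp (- x)) * indicator {0..} x \<partial>lborel) = 1"
    using nn_intergal_power_times_exp_Ici[of 1] by simp
  have "(\<integral>\<^sup>+x. ennreal (\<bar>x\<bar> * exp (- \<bar>x\<bar>)) \<partial>lborel) \<le>
      (\<integral>\<^sup>+x. ennreal (x * exp (- x)) * indicator {0..} x +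
             ennreal (- x * exp (- (- x))) * indicator {0..} (- x) \<partial>lborel)"
    by (intro nn_integral_mono) (auto simp: indicator_def)
  also have "\<dots> = 1 + (\<integral>\<^sup>+x. ennreal (- x * exp (- (- x))) * indicator {0..} (- x) \<partial>lborel)"
    by (subst nn_integral_add) (simp_all only: half, measurable)
  also have "(\<integral>\<^sup>+x. ennreal (- x * exp (- (- x))) * indicator {0..} (- x) \<partial>lborel) = 1"
    using nn_integral_real_affine[of "\<lambda>x. ennreal (x * exp (- x)) * indicator {0..} x" "- 1" 0] half
    by simp
  finally have "(\<integral>\<^sup>+x. ennreal (\<bar>x\<bar> * exp (- \<bar>x\<bar>)) \<partial>lborel) < \<infinity>"
    by (simp add: le_less_trans)
  then have "integrable lborel (\<lambda>x::real. \<bar>x\<bar> * exp (- \<bar>x\<bar>))"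
    by (intro integrableI_bounded) auto
  then have "integrable lborel (\<lambda>x::real. (exp (- x) * exp (- exp (- x))) *\<^sub>R x)"
  proof (rule Bochner_Integration.integrable_bound)
    show "AE x in lborel. norm ((exp (- x) * exp (- exp (- x))) *\<^sub>R x) \<le> norm (\<bar>x\<bar> * exp (- \<bar>x\<bar>))"
      using bound by (auto simp: abs_mult mult.commute[of _ "\<bar>_\<bar>"] intro!: mult_left_mono)
  qed simp
  then show ?thesis
    by (subst density_gumbel, subst integrable_density) auto
qed

text \<open>The extra factor only rescales the inner exponential from 1 to 1 + c, so an
  antiderivative is explicit. The integrand will be the chance that all competitors stay below
  x.\<close>

lemma nn_integral_exp_gumbel:
  assumes "0 \<le> c"
  shows "(\<integral>\<^sup>+x. ennreal (exp (- (c * exp (- x)))) \<partial>L) = ennreal (1 / (1 + c))"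
proof -
  let ?f = "\<lambda>x. exp (- x) * exp (- exp (- x)) * exp (- (c * exp (- x)))"
  let ?F = "\<lambda>x. exp (- ((1 + c) * exp (- x))) / (1 + c)"
  have "(\<integral>\<^sup>+x. ennreal (exp (- (c * exp (- x)))) \<partial>L) = (\<integral>\<^sup>+x. ennreal (?f x) \<partial>lborel)"
    by (subst density_gumbel, subst nn_integral_density) (auto simp: ennreal_mult')
  also have "\<dots> = ennreal (1 / (1 + c) - 0)"
  proof (rule nn_integral_FTC_UNIV)
    have c: "1 + c > 0" "1 + c \<noteq> 0"
      using assms by auto
    show "DERIV ?F x :> ?f x" for x
    proof -
      have "DERIV (\<lambda>x. exp (- (b * exp (- x))) / b) x :> exp (- x) * exp (- (b * exp (- x)))"
        if "b \<noteq> 0" for b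
        using that by (auto intro!: derivative_eq_intros)
      then have "DERIV ?F x :> exp (- x) * exp (- ((1 + c) * exp (- x)))"
        using c(2) .
      also have "exp (- x) * exp (- ((1 + c) * exp (- x))) = ?f x"
        by (simp add: exp_add[symmetric] algebra_simps)
      finally show ?thesis .
    qed
    define b where "b = 1 + c"
    have "((\<lambda>x. exp (- (b * exp (- x))) / b) \<longlongrightarrow> 0) at_bot"
      "((\<lambda>x. exp (- (b * exp (- x))) / b) \<longlongrightarrow> inverse b) at_top"
      using c(1) unfolding b_def[symmetric] by real_asymp+
    then show "(?F \<longlongrightarrow> 0) at_bot" "(?F \<longlongrightarrow> 1 / (1 + c)) at_top"
      by (simp_all add: b_def inverse_eq_divide)
  qed auto
  finally show ?thesis
    by simp
qed

text \<open>Condition on the coordinate u. Independence makes the chance that it dominates a product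
  of Gumbel distribution functions, whose exponents add up.\<close>

lemma prob_maximizer_softmax:
  fixes G :: "'w \<Rightarrow> real^'a::finite"
  assumes "prob_space M" and G: "G \<in> borel_measurable M"
    and indep: "prob_space.indep_vars M (\<lambda>_. borel) (\<lambda>u \<omega>. G \<omega> $ u) UNIV"
    and L: "\<forall>u. distr M borel (\<lambda>\<omega>. G \<omega> $ u) = L"
  shows "measure M {\<omega>\<in>space M. u \<in> maximizers (G \<omega>) \<tau>} = softmax \<tau> $ u"
proof -
  interpret M: prob_space M by fact
  interpret P: product_sigma_finite "\<lambda>_::'a. L" ..
  have [measurable]: "(\<lambda>\<omega>. G \<omega> $ v) \<in> borel_measurable M" for v
    using G by (rule borel_measurable_nth)
  define X where "X \<omega> = (\<lambda>v. G \<omega> $ v)" for \<omega>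
  have X [measurable]: "X \<in> measurable M (Pi\<^sub>M UNIV (\<lambda>_. borel))"
    unfolding X_def by (rule measurable_PiM_single') (simp_all add: space_PiM)
  have distr: "distr M (Pi\<^sub>M UNIV (\<lambda>_. borel)) X = Pi\<^sub>M UNIV (\<lambda>_. L)"
    using M.indep_vars_iff_distr_eq_PiM[of UNIV "\<lambda>u \<omega>. G \<omega> $ u" "\<lambda>_. borel"] indep L
    by (simp add: X_def[abs_def] restrict_UNIV)
  \<comment> \<open>Total weight of the competitors relative to u.\<close>
  define c where "c = (\<Sum>v\<in>UNIV - {u}. exp (\<tau> $ v - \<tau> $ u))"
  define A where "A = {x \<in> space (Pi\<^sub>M UNIV (\<lambda>_. borel :: real measure)). \<forall>v. x v + \<tau> $ v \<le> x u + \<tau> $ u}"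
  have A: "A \<in> sets (Pi\<^sub>M UNIV (\<lambda>_. borel))"
  proof -
    have "(\<lambda>x. x v) \<in> borel_measurable (Pi\<^sub>M UNIV (\<lambda>_. borel :: real measure))"
      for v :: 'a
      by (rule measurable_component_singleton) simp
    then have "{x \<in> space (Pi\<^sub>M UNIV (\<lambda>_. borel :: real measure)). x v + \<tau> $ v \<le> x u + \<tau> $ u}
        \<in> sets (Pi\<^sub>M UNIV (\<lambda>_. borel))" for v
      by (intro borel_measurable_le borel_measurable_add borel_measurable_const)
    then show ?thesis
      unfolding A_def by (intro sets.sets_Collect_countable_All)
  qed
  have sets_PL: "sets (Pi\<^sub>M I (\<lambda>_. L)) = sets (Pi\<^sub>M I (\<lambda>_. borel))" for I :: "'a set"
    by (intro sets_PiM_cong) simp_all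
  have "emeasure M {\<omega>\<in>space M. u \<in> maximizers (G \<omega>) \<tau>} = emeasure M (X -` A \<inter> space M)"
    by (intro arg_cong[where f = "emeasure M"]) (auto simp: A_def X_def maximizers_iff space_PiM)
  also have "\<dots> = emeasure (Pi\<^sub>M UNIV (\<lambda>_. L)) A"
    unfolding distr[symmetric] using X A by (rule emeasure_distr[symmetric])
  also have "\<dots> = (\<integral>\<^sup>+x. indicator A x \<partial>Pi\<^sub>M (insert u (UNIV - {u})) (\<lambda>_. L))"
    using A by (simp add: insert_absorb sets_PL)
  also have "\<dots> = (\<integral>\<^sup>+y. (\<integral>\<^sup>+x. indicator A (x(u := y)) \<partial>Pi\<^sub>M (UNIV - {u}) (\<lambda>_. L)) \<partial>L)"
    using A by (intro P.product_nn_integral_insert_rev) (simp_all add: insert_absorb sets_PL)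
  also have "\<dots> = (\<integral>\<^sup>+y. ennreal (exp (- (c * exp (- y)))) \<partial>L)"
  proof (rule nn_integral_cong)
    fix y
    let ?B = "\<lambda>v. {..y + \<tau> $ u - \<tau> $ v}"
    \<comment> \<open>Once coordinate u equals y, the event is a box of half-lines in the other
      coordinates; the comparison of u with itself is trivial.\<close>
    have "(\<integral>\<^sup>+x. indicator A (x(u := y)) \<partial>Pi\<^sub>M (UNIV - {u}) (\<lambda>_. L)) =
        (\<integral>\<^sup>+x. indicator (Pi\<^sub>E (UNIV - {u}) ?B) x \<partial>Pi\<^sub>M (UNIV - {u}) (\<lambda>_. L))"
      by (intro nn_integral_cong)
        (auto simp: A_def indicator_def space_PiM PiE_iff algebra_simps split: if_splits)
    also have "\<dots> = (\<Prod>v\<in>UNIV - {u}. emeasure L (?B v))"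
      by (subst nn_integral_indicator) (auto intro!: P.emeasure_PiM sets_PiM_I_finite)
    also have "\<dots> = (\<Prod>v\<in>UNIV - {u}. ennreal (exp (- (exp (\<tau> $ v - \<tau> $ u) * exp (- y)))))"
    proof (rule prod.cong)
      fix v
      have "emeasure L (?B v) = ennreal (exp (- exp (- (y + \<tau> $ u - \<tau> $ v))))"
        using cdf_gumbel[of "y + \<tau> $ u - \<tau> $ v"] unfolding cdf_def
        by (simp only: emeasure_eq_measure)
      also have "exp (- (y + \<tau> $ u - \<tau> $ v)) = exp (\<tau> $ v - \<tau> $ u) * exp (- y)"
        by (simp add: exp_add[symmetric])
      finally show "emeasure L (?B v) = ennreal (exp (- (exp (\<tau> $ v - \<tau> $ u) * exp (- y))))" .
    qed simp
    also have "\<dots> = ennreal (exp (- (c * exp (- y))))"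
      by (simp add: prod_ennreal exp_sum[symmetric] c_def sum_distrib_right sum_negf)
    finally show "(\<integral>\<^sup>+x. indicator A (x(u := y)) \<partial>Pi\<^sub>M (UNIV - {u}) (\<lambda>_. L)) =
        ennreal (exp (- (c * exp (- y))))" .
  qed
  also have "\<dots> = ennreal (1 / (1 + c))"
    by (rule nn_integral_exp_gumbel) (simp add: c_def sum_nonneg)
  \<comment> \<open>The summand 1 is the term v = u, so this is the full softmax denominator divided
    by its numerator.\<close>
  also have "1 + c = (\<Sum>v\<in>UNIV. exp (\<tau> $ v)) / exp (\<tau> $ u)"
  proof -
    have "(\<Sum>v\<in>UNIV. exp (\<tau> $ v)) / exp (\<tau> $ u) = (\<Sum>v\<in>UNIV. exp (\<tau> $ v - \<tau> $ u))"
      by (simp add: exp_diff sum_divide_distrib)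
    then show ?thesis
      by (simp add: c_def sum.remove[of UNIV u])
  qed
  finally show ?thesis
    using softmax_pos[of \<tau> u] by (simp add: measure_def softmax_def)
qed

end

section \<open>Passing from the random vector to its law on the support\<close>

lemma measure_law_on_support:
  fixes G :: "'w \<Rightarrow> 'b::second_countable_topology"
  assumes "prob_space M" and G: "G \<in> borel_measurable M" and A: "A \<in> sets borel"
  shows "measure (law_on_support M G) (A \<inter> space (law_on_support M G)) = measure M {\<omega>\<in>space M. G \<omega> \<in> A}"
proof -
  let ?P = "distr M borel G"
  let ?S = "measure_support ?P"
  interpret P: prob_space ?P
    using assms by (intro prob_space.prob_space_distr)
  interpret N: prob_space "law_on_support M G"
    using assms by (intro prob_space_law_on_support)
  have space: "space (law_on_support M G) = ?S"
    using assms by (intro prob_space_law_on_support)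
  have S: "?S \<in> sets borel"
    by (simp add: closed_measure_support)
  have N: "emeasure (law_on_support M G) B = emeasure ?P B" if "B \<subseteq> ?S" for B
    unfolding law_on_support_def using S that by (intro emeasure_restrict_space) auto
  \<comment> \<open>The restricted law has total mass 1, so the support carries all the mass and
    intersecting with it loses nothing.\<close>
  have "AE x in ?P. x \<in> ?S"
    using N.emeasure_space_1 N[of ?S] S by (intro P.AE_prob_1) (simp add: space measure_def)
  then have "emeasure ?P (A \<inter> ?S) = emeasure ?P A"
    using A S by (intro emeasure_eq_AE) auto
  also have "\<dots> = emeasure M {\<omega>\<in>space M. G \<omega> \<in> A}"
    using G A by (simp add: emeasure_distr vimage_def Int_def conj_commute)
  finally show ?thesis
    using N[of "A \<inter> ?S"] by (simp add: space measure_def)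
qed

lemma integrable_law_on_support:
  fixes G :: "'w \<Rightarrow> real^'a::finite"
  assumes "prob_space M" and G: "G \<in> borel_measurable M"
    and int: "\<And>u. integrable M (\<lambda>\<omega>. G \<omega> $ u)"
  shows "integrable_law (law_on_support M G)"
proof -
  interpret N: prob_space "law_on_support M G"
    using assms by (intro prob_space_law_on_support)
  have "integrable (distr M borel G) (\<lambda>g. g $ u)" for u
    using int G by (simp add: integrable_distr_eq borel_measurable_nth)
  then have "integrable (law_on_support M G) (\<lambda>g. g $ u)" for u
    unfolding law_on_support_def
    by (subst integrable_restrict_space)
      (simp_all add: closed_measure_support integrable_mult_indicator del: real_scaleR_def)
  then show ?thesis
    by unfold_locales
qed

theorem theoremD3:
  fixes p :: "real^'a::finite"
    and M :: "'w measure" and G :: "'w \<Rightarrow> real^'a"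
    and L :: "real measure" and \<epsilon> :: real
  assumes "p \<in> prob_vectors" and "\<forall>u. 0 < p $ u"
    and "prob_space M" and "G \<in> borel_measurable M"
    and "prob_space.indep_vars M (\<lambda>_. borel) (\<lambda>u \<omega>. G \<omega> $ u) UNIV"
    and "\<forall>u. distr M borel (\<lambda>\<omega>. G \<omega> $ u) = L"
    and "0 \<le> \<epsilon>"
  shows "let D = law_on_support M G in
    (integrable L (\<lambda>x. x) \<longrightarrow>
      (\<exists>\<tau> T. tie_breaking D \<tau> T \<and>
         optimal D p \<epsilon> (threshold_policy \<tau> T) \<and>
         (if \<exists>T0. tie_breaking D 0 T0 \<and> feasible D p \<epsilon> (threshold_policy 0 T0)
          then \<tau> = 0
          else KL (mean D (threshold_policy \<tau> T)) p = \<epsilon>))) \<and>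
    ((\<forall>x. cdf L x = exp (- exp (- x))) \<longrightarrow>
      (\<exists>\<alpha>\<in>{0..1}. \<exists>q. optimal D p \<epsilon> q \<and>
         (AE g in D. q g = gumbel_rule \<alpha> p g) \<and>
         (if \<exists>\<beta>\<in>{0..1}. KL (mean D (gumbel_rule \<beta> p)) p = \<epsilon>
          then KL (mean D q) p = \<epsilon>
          else \<alpha> = 0)))"
proof -
  define D where "D = law_on_support M G"
  have nth: "(\<lambda>\<omega>. G \<omega> $ u) \<in> borel_measurable M" for u
    using assms(4) by (rule borel_measurable_nth)
  have law: "integrable_law D" if "integrable L (\<lambda>x. x)"
    unfolding D_def using assms(3,4)
  proof (rule integrable_law_on_support)
    fix u
    have "integrable (distr M borel (\<lambda>\<omega>. G \<omega> $ u)) (\<lambda>x. x)"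
      using that assms(6) by simp
    then show "integrable M (\<lambda>\<omega>. G \<omega> $ u)"
      using nth by (simp add: integrable_distr_eq)
  qed
  have gumbel: "\<exists>\<alpha>\<in>{0..1}. \<exists>q. optimal D p \<epsilon> q \<and> (AE g in D. q g = gumbel_rule \<alpha> p g) \<and>
      (if \<exists>\<beta>\<in>{0..1}. KL (mean D (gumbel_rule \<beta> p)) p = \<epsilon> then KL (mean D q) p = \<epsilon> else \<alpha> = 0)"
    if cdf: "\<forall>x. cdf L x = exp (- exp (- x))"
  proof -
    \<comment> \<open>\<open>undefined\<close> merely names some index; all coordinates share the
      law L.\<close>
    have "prob_space (distr M borel (\<lambda>\<omega>. G \<omega> $ undefined))"
      using assms(3) nth by (rule prob_space.prob_space_distr)
    then interpret L: prob_space L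
      using assms(6) by simp
    have "sets L = sets borel"
      using assms(6) sets_distr by metis
    then interpret L: gumbel L
      using cdf by unfold_locales auto
    interpret integrable_law D
      using L.integrable_gumbel by (rule law)
    have "measure D {g\<in>space D. u \<in> maximizers g \<tau>} = softmax \<tau> $ u" for \<tau> u
    proof -
      \<comment> \<open>Weak inequalities cut out a closed, hence Borel, set, so its probability can
        be computed on the original space.\<close>
      have "closed {g::real^'a. u \<in> maximizers g \<tau>}"
        unfolding maximizers_iff by (intro closed_Collect_all closed_Collect_le continuous_intros)
      then have "measure D ({g. u \<in> maximizers g \<tau>} \<inter> space D) =
          measure M {\<omega>\<in>space M. G \<omega> \<in> {g. u \<in> maximizers g \<tau>}}"
        unfolding D_def using assms(3,4) by (intro measure_law_on_support) auto
      also have "\<dots> = softmax \<tau> $ u"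
        using L.prob_maximizer_softmax[OF assms(3-6)] by simp
      finally show ?thesis
        by (simp add: Int_def conj_commute)
    qed
    with assms(1,2,7) show ?thesis
      by (rule optimal_gumbel_rule)
  qed
  show ?thesis
    unfolding Let_def D_def[symmetric]
    using integrable_law.optimal_threshold_policy[OF law assms(1,2,7)] gumbel by blast
qed

end
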